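(* For state-aware algorithms, the topological stability ratios of the first principal component (PC), the oriented bounding box (OBB) and the covering strip (STRIP) are $$\rho_{TS}(\text{PC})=1,\qquad \rho_{TS}(\text{OBB})=\tfrac54,\qquad \rho_{TS}(\text{STRIP})=\sqrt2 .$$
   Context: A continuously moving point set is $P(t)=\{p_1(t),\dots,p_n(t)\}$, $t\in[0,T]$, with $n$ any finite number of points, where each $p_i:[0,T]\to\mathbb{R}^2$ is continuous and at each time $t$ not all points are at the same position. An orientation is an element of the real projective line $O=\mathbb{RP}^1$ (topologically a circle), represented by a unit vector $\alpha\in\mathbb{R}^2$ with opposite vectors identified. Let $\alpha^\perp$ be the orientation orthogonal to $\alpha$, $w_\alpha(P)=\max_{p,q\in P}(p-q)\cdot\alpha$ the extent of $P$ along $\alpha$, $\mathcal{L}(\alpha)$ the set of lines with orientation $\alpha$, and $d(L,p)$ the Euclidean distance from the point $p$ to the line $L$. The cost functions are - $f_{\text{PC}}(\alpha,P)=\min_{L\in\mathcal{L}(\alpha)}\sum_{p\in P}d(L,p)^2$, - $f_{\text{OBB}}(\alpha,P)=w_\alpha(P)\,w_{\alpha^\perp}(P)$, - $f_{\text{STRIP}}(\alpha,P)=w_{\alpha^\perp}(P)$. A state-aware algorithm $\mathcal{A}$ produces, for a moving point set, an orientation at every time $t$; it has access to the input $P(t)$ at the current time and maintains a state over time (such as its earlier output), so its outputs at two times with equal inputs may differ. The output at time $t$ is denoted $\mathcal{A}(P(t))$, the state being implicit. The output may change arbitrarily fast, but must be continuous in $t$. The topological stability ratio of a shape descriptor $\Pi$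 is $$\rho_{TS}(\Pi)=\inf_{\mathcal{A}}\sup_{P(t)}\max_{t\in[0,T]}\frac{f_\Pi(\mathcal{A}(P(t)),P(t))}{\min_\gamma f_\Pi(\gamma,P(t))},$$ where the supremum is over all continuously moving point sets and the infimum is over all (state-aware) algorithms for which $\mathcal{A}(P(t))$ is continuous in $t$. Convention: if the minimum cost is $0$, the ratio is $1$ if the numerator is $0$ and $\infty$ otherwise. *)

theory Defs
  imports "HOL-Analysis.Analysis"
begin

section \<open>Orientations\<close>

type_synonym plane = "real ^ 2"

quotient_type orientation = plane / partial:
  "\<lambda>u v. norm u = 1 \<and> norm v = 1 \<and> (u = v \<or> u = - v)"
  morphisms rep_orientation orientation_of
proof (rule part_equivpI)
  show "\<exists>u::plane. norm u = 1 \<and> norm u = 1 \<and> (u = u \<or> u = - u)"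
    using vector_choose_size[of 1] by auto
qed (auto intro!: sympI transpI)

text \<open>The topology of the real projective line: the quotient topology of the unit circle.\<close>

instantiation orientation :: topological_space
begin

definition open_orientation :: "orientation set \<Rightarrow> bool" where
  "open_orientation U \<longleftrightarrow>
     openin (top_of_set (sphere 0 1)) {v \<in> sphere 0 1. orientation_of v \<in> U}"

instance
proof
  show "open (UNIV :: orientation set)"
    using openin_topspace[of "top_of_set (sphere (0::plane) 1)"]
    by (simp add: open_orientation_def del: openin_topspace) (simp add: sphere_def)
next
  fix S T :: "orientation set"
  have "{v \<in> sphere 0 1. orientation_of v \<in> S \<inter> T}
      = {v \<in> sphere 0 1. orientation_of v \<in> S} \<inter> {v \<in> sphere 0 1. orientation_of v \<in> T}"
    by auto
  moreover assume "open S" "open T"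
  ultimately show "open (S \<inter> T)"
    unfolding open_orientation_def by (simp only: openin_Int)
next
  fix K :: "orientation set set"
  assume *: "\<forall>S\<in>K. open S"
  have "{v \<in> sphere 0 1. orientation_of v \<in> \<Union>K}
      = (\<Union>S\<in>K. {v \<in> sphere 0 1. orientation_of v \<in> S})"
    by auto
  then show "open (\<Union>K)"
    using * unfolding open_orientation_def by (auto intro!: openin_Union)
qed

end

definition rot90 :: "plane \<Rightarrow> plane" where
  "rot90 v = vector [- (v $ 2), v $ 1]"

lemma rot90_minus: "rot90 (- v) = - rot90 v"
  by (simp add: rot90_def vec_eq_iff forall_2)

lemma norm_rot90: "norm (rot90 v) = norm v"
  by (simp add: rot90_def norm_eq_sqrt_inner inner_vec_def sum_2)

lift_definition perp :: "orientation \<Rightarrow> orientation" is rot90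
  by (auto simp: rot90_minus norm_rot90)

lift_definition lines :: "orientation \<Rightarrow> plane set set" is
  "\<lambda>v. {L. \<exists>c. L = {c + s *\<^sub>R v | s. True}}"
proof -
  fix u v :: plane
  assume "norm u = 1 \<and> norm v = 1 \<and> (u = v \<or> u = - v)"
  moreover have "{c + s *\<^sub>R (- v) | s. True} = {c + s *\<^sub>R v | s. True}" for c
  proof -
    have "(\<exists>s. x = c + s *\<^sub>R (- v)) \<longleftrightarrow> (\<exists>s. x = c + s *\<^sub>R v)" for x
      by (metis minus_minus scaleR_minus_left scaleR_minus_right)
    then show ?thesis by auto
  qed
  ultimately show "{L. \<exists>c. L = {c + s *\<^sub>R u | s. True}} = {L. \<exists>c. L = {c + s *\<^sub>R v | s. True}}"
    by (elim conjE disjE) simp_all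
qed

section \<open>Point sets and cost functions\<close>

text \<open>A point set of size \<open>n\<close> is an indexed family \<open>P 0, \<dots>, P (n - 1)\<close>, so points that
  happen to coincide are still counted separately in the sum of squared distances.\<close>

lift_definition extent :: "orientation \<Rightarrow> nat \<Rightarrow> (nat \<Rightarrow> plane) \<Rightarrow> real" is
  "\<lambda>v n P. Max {(P i - P j) \<bullet> v | i j. i < n \<and> j < n}"
proof (intro ext)
  fix u v :: plane and n and P :: "nat \<Rightarrow> plane"
  assume "norm u = 1 \<and> norm v = 1 \<and> (u = v \<or> u = - v)"
  moreover have "{(P i - P j) \<bullet> (- v) | i j. i < n \<and> j < n} = {(P i - P j) \<bullet> v | i j. i < n \<and> j < n}"
  proof -
    have "(P i - P j) \<bullet> (- v) = (P j - P i) \<bullet> v" for i j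
      by (simp add: inner_diff_left)
    then show ?thesis by (simp only:) blast
  qed
  ultimately show "Max {(P i - P j) \<bullet> u | i j. i < n \<and> j < n} =
      Max {(P i - P j) \<bullet> v | i j. i < n \<and> j < n}"
    by (elim conjE disjE) (simp_all only:)
qed

definition f_PC :: "orientation \<Rightarrow> nat \<Rightarrow> (nat \<Rightarrow> plane) \<Rightarrow> real" where
  "f_PC \<alpha> n P = (INF L\<in>lines \<alpha>. \<Sum>i<n. (infdist (P i) L)\<^sup>2)"

definition f_OBB :: "orientation \<Rightarrow> nat \<Rightarrow> (nat \<Rightarrow> plane) \<Rightarrow> real" where
  "f_OBB \<alpha> n P = extent \<alpha> n P * extent (perp \<alpha>) n P"

definition f_STRIP :: "orientation \<Rightarrow> nat \<Rightarrow> (nat \<Rightarrow> plane) \<Rightarrow> real" where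
  "f_STRIP \<alpha> n P = extent (perp \<alpha>) n P"

section \<open>Moving point sets and state-aware algorithms\<close>

definition moving_point_set :: "nat \<Rightarrow> real \<Rightarrow> (nat \<Rightarrow> real \<Rightarrow> plane) \<Rightarrow> bool" where
  "moving_point_set n T p \<longleftrightarrow>
     0 < T \<and> (\<forall>i<n. continuous_on {0..T} (p i)) \<and>
     (\<forall>t\<in>{0..T}. \<exists>i<n. \<exists>j<n. p i t \<noteq> p j t)"

text \<open>\<open>A n p t\<close> is the output at time \<open>t\<close> on the input \<open>p\<close> with \<open>n\<close> points.  What an algorithm can
  use at time \<open>t\<close> is the current input and a state built up over time, hence the input on \<open>[0, t]\<close>
  and nothing else (neither later input nor the time horizon).  Conversely the state may
  record all earlier inputs and outputs.\<close>

definition state_aware :: "(nat \<Rightarrow> (nat \<Rightarrow> real \<Rightarrow> plane) \<Rightarrow> real \<Rightarrow> orientation) \<Rightarrow> bool" where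
  "state_aware A \<longleftrightarrow>
     (\<forall>n T p T' q. moving_point_set n T p \<longrightarrow> moving_point_set n T' q \<longrightarrow>
        (\<forall>t. 0 \<le> t \<and> t \<le> T \<and> t \<le> T' \<longrightarrow>
           (\<forall>i<n. \<forall>s\<in>{0..t}. p i s = q i s) \<longrightarrow> A n p t = A n q t))"

definition continuous_output :: "(nat \<Rightarrow> (nat \<Rightarrow> real \<Rightarrow> plane) \<Rightarrow> real \<Rightarrow> orientation) \<Rightarrow> bool" where
  "continuous_output A \<longleftrightarrow>
     (\<forall>n T p. moving_point_set n T p \<longrightarrow> continuous_on {0..T} (A n p))"

section \<open>Topological stability ratio\<close>

text \<open>The infima over lines and over orientations are attained, so they are the minimal costs;
  the costs are nonnegative, so the case \<open>m = 0\<close> covers everything excluded from division.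
  The supremum over \<open>t\<close> equals the maximum whenever the latter exists.\<close>

definition cost_ratio ::
    "(orientation \<Rightarrow> nat \<Rightarrow> (nat \<Rightarrow> plane) \<Rightarrow> real) \<Rightarrow> orientation \<Rightarrow> nat \<Rightarrow> (nat \<Rightarrow> plane) \<Rightarrow> ereal" where
  "cost_ratio f \<alpha> n P =
     (let m = (INF \<gamma>. f \<gamma> n P) in
      if m = 0 then (if f \<alpha> n P = 0 then 1 else \<infinity>) else ereal (f \<alpha> n P / m))"

definition rho_TS :: "(orientation \<Rightarrow> nat \<Rightarrow> (nat \<Rightarrow> plane) \<Rightarrow> real) \<Rightarrow> ereal" where
  "rho_TS f =
     (INF A\<in>{A. state_aware A \<and> continuous_output A}.
      SUP (n, T, p)\<in>{(n, T, p). moving_point_set n T p}.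
      SUP t\<in>{0..T}. cost_ratio f (A n p t) n (\<lambda>i. p i t))"

end

theory Submission imports Defs
begin

text \<open>
  Upper bounds. Let the cost of an angle be such that any two angles of cost at most \<open>K\<close> are joined by an
  interval of angles of cost at most \<open>c K\<close>.  An algorithm that keeps an almost optimal target angle
  and runs towards it at a pace given by the displacement of the normalised cost function then has
  ratio close to \<open>c\<close>: when the target stops being almost optimal, it has been reached, and a new
  target can be chosen.  Where the minimal cost is 0 the ratio forces the output to be optimal.
  The connectedness property holds with \<open>c = 1\<close> for PC, whose cost is a sinusoid of the doubled angle;
  with \<open>c = \<surd>2\<close> for STRIP, since the width is a seminorm of the direction and
  two orientations enclose at most a right angle; and with \<open>c = 5/4\<close> for OBB, where of the two ways to rotate one
  box into another (angles \<open>\<phi>\<close> and \<open>\<pi>/2 - \<phi>\<close>) at least one is cheap.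

  Lower bounds. A rectangle turning from 2 by 1 to 1 by 2 (STRIP) and a sheared rhombus (OBB)
  force every continuous output across orientations of ratio at least \<open>\<surd>2\<close> and \<open>5/4\<close>.
\<close>

section \<open>Causal tracking\<close>

text \<open>The input may move arbitrarily fast and its future is unknown, so the algorithm has no
  modulus of continuity to rely on. Measuring progress by distance in the sup norm avoids the need
  for one: on a compact time interval with positive minimal cost, a continuous path completes only
  finitely many moves of length \<open>e\<close>, and the past alone determines every turn. Dividing
  a cost function by its minimum turns the cost ratio into a function value, so one \<open>e\<close>
  serves all point sets. The price is that the normalisation breaks down where the minimum is 0; the
  times where it exists form an open set whose components need have no first instant, and starting
  causally on such a component is the main obstacle. Slack is spent twice, \<open>e\<close> before
  and \<open>e\<close> after the input departs from a reference path; this is the origin of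
  \<open>2 * e\<close>. Each algorithm therefore exceeds the constant slightly, and only the infimum
  over algorithms removes the excess.\<close>

text \<open>\<open>T a y \<theta> \<alpha>\<close> says that from angle \<open>\<theta>\<close> one may safely move to \<open>\<alpha>\<close> when the current configuration is \<open>y\<close>;
  \<open>a\<close> is the slack already consumed.  While the configuration stays within distance \<open>e\<close> of \<open>y\<close> the
  move remains safe with slack \<open>a + e\<close>, and once \<open>\<alpha>\<close> is reached a new target without any
  consumed slack is available.\<close>

locale tracking =
  fixes T :: "real \<Rightarrow> 'y::metric_space \<Rightarrow> real \<Rightarrow> real \<Rightarrow> bool" and e :: real and G :: "'y set"
  assumes e_pos: "0 < e"
    and T_mono: "T a y \<theta> \<alpha> \<Longrightarrow> a \<le> b \<Longrightarrow> T b y \<theta> \<alpha>"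
    and T_shift: "T a y \<theta> \<alpha> \<Longrightarrow> dist y y' \<le> e \<Longrightarrow> \<theta>' \<in> closed_segment \<theta> \<alpha> \<Longrightarrow> T (a + e) y' \<theta>' \<alpha>"
    and T_fresh: "y \<in> G \<Longrightarrow> T (2 * e) y \<alpha> \<alpha> \<Longrightarrow> \<exists>\<beta>. T 0 y \<alpha> \<beta>"
    and T_init: "y \<in> G \<Longrightarrow> \<exists>\<theta> \<alpha>. T 0 y \<theta> \<alpha>"
begin

definition target :: "real \<Rightarrow> 'y \<Rightarrow> real \<Rightarrow> real" where
  "target a y \<theta> = (SOME \<alpha>. T a y \<theta> \<alpha>)"

text \<open>The progress of a move is driven by the distance travelled by the input and not by time: the move
  is completed exactly when that distance reaches \<open>e\<close>, however fast this happens.\<close>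

definition move :: "(real \<Rightarrow> 'y) \<Rightarrow> real \<Rightarrow> real \<Rightarrow> real \<Rightarrow> real \<Rightarrow> real" where
  "move g a s \<theta> t = \<theta> + (target a (g s) \<theta> - \<theta>) * (dist (g s) (g t) / e)"

text \<open>A relation rather than a recursive function: the number of turns before \<open>t\<close>
  depends on \<open>g\<close>, and continuity is what makes it finite. Induction on the relation
  follows the turns.\<close>

inductive track :: "(real \<Rightarrow> 'y) \<Rightarrow> real \<Rightarrow> real \<Rightarrow> real \<Rightarrow> real \<Rightarrow> real \<Rightarrow> bool" for g a where
  last: "s \<le> t \<Longrightarrow> (\<forall>r\<in>{s..t}. dist (g s) (g r) < e) \<Longrightarrow> track g a s \<theta> t (move g a s \<theta> t)"
| turn: "r \<in> {s..t} \<Longrightarrow> dist (g s) (g r) = e \<Longrightarrow> (\<forall>r'\<in>{s..<r}. dist (g s) (g r') < e) \<Longrightarrow>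
    track g a r (target a (g s) \<theta>) t x \<Longrightarrow> track g a s \<theta> t x"

text \<open>The two rules exclude each other and the first exit time in \<open>turn\<close> is
  unique, so a run is deterministic.\<close>

lemma track_unique:
  assumes "track g a s \<theta> t x" "track g a s \<theta> t x'"
  shows "x = x'"
  using assms
proof (induction arbitrary: x' rule: track.induct)
  case (last s t \<theta>)
  from last.prems show ?case
    by cases (use last.hyps in force)+
next
  case (turn r s t \<theta> x)
  from turn.prems show ?case
  proof cases
    case last
    then show ?thesis using turn.hyps by force
  next
    case t2: (turn r')
    have "r' = r"
      using turn.hyps t2 by (metis atLeastAtMost_iff atLeastLessThan_iff less_irrefl not_less_iff_gr_or_eq)
    then show ?thesis using turn.IH t2 by simp
  qed
qed

text \<open>This is the causality of a run: both rules read \<open>g\<close> only on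
  \<open>{s..t}\<close>.\<close>

lemma track_cong:
  assumes "track g a s \<theta> t x" "\<And>r. r \<in> {s..t} \<Longrightarrow> g r = g' r"
  shows "track g' a s \<theta> t x"
  using assms
proof (induction rule: track.induct)
  case (last s t \<theta>)
  then have "move g a s \<theta> t = move g' a s \<theta> t"
    by (simp add: move_def)
  moreover have "track g' a s \<theta> t (move g' a s \<theta> t)"
    using last by (intro track.last) auto
  ultimately show ?case by simp
next
  case (turn r s t \<theta> x)
  have eq: "g r' = g' r'" if "r' \<in> {s..t}" for r' using turn.prems that by simp
  have "track g' a r (target a (g' s) \<theta>) t x"
    using turn.IH turn.hyps(1) eq[of s] eq by auto
  moreover have "dist (g' s) (g' r) = e" "\<forall>r'\<in>{s..<r}. dist (g' s) (g' r') < e"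
    using turn.hyps(1-3) eq[symmetric] by simp_all
  ultimately show ?case
    by (intro track.turn[OF turn.hyps(1)])
qed

lemma first_exit:
  fixes g :: "real \<Rightarrow> 'y"
  assumes "continuous_on {s..h} g" "r0 \<in> {s..h}" "e \<le> dist (g s) (g r0)"
  obtains r where "r \<in> {s..h}" "dist (g s) (g r) = e" "\<forall>r'\<in>{s..<r}. dist (g s) (g r') < e"
proof -
  let ?d = "\<lambda>r. dist (g s) (g r)"
  have contd: "continuous_on {s..h} ?d" by (intro continuous_intros assms)
  let ?X = "{r \<in> {s..h}. e \<le> ?d r}"
  have "closed ?X"
    using continuous_on_closed_Collect_le[OF continuous_on_const contd] by simp
  then have "compact ?X"
    by (metis (no_types, lifting) bounded_closed_interval bounded_subset compact_eq_bounded_closed mem_Collect_eq subsetI)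
  then obtain r where r: "r \<in> ?X" "\<And>r'. r' \<in> ?X \<Longrightarrow> r \<le> r'"
    using compact_attains_inf[of ?X] assms by blast
  have "\<exists>x\<ge>s. x \<le> r \<and> ?d x = e"
    using r e_pos by (intro IVT' continuous_on_subset[OF contd]) auto
  then obtain x where x: "s \<le> x" "x \<le> r" "?d x = e" by blast
  have "r = x" using r x by (intro antisym) auto
  then show ?thesis
    using r x that[of r] by (force simp: not_le[symmetric])
qed

text \<open>Uniform continuity yields a time \<open>d\<close> below which the input cannot travel
  the distance \<open>e\<close>. Every completed move thus lasts at least \<open>d\<close>, and
  \<open>n\<close> bounds the number of moves up to the horizon \<open>h\<close>.\<close>

lemma track_exists:
  assumes cont: "continuous_on {s..h} g" and G: "\<And>r. r \<in> {s..h} \<Longrightarrow> g r \<in> G" and "s \<le> h"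
    and a: "0 \<le> a" "a \<le> e" and T: "\<exists>\<alpha>. T a (g s) \<theta> \<alpha>"
  shows "\<exists>S. continuous_on {s..h} S \<and> S s = \<theta> \<and>
    (\<forall>t\<in>{s..h}. track g a s \<theta> t (S t) \<and> (\<exists>\<alpha>. T (a + e) (g t) (S t) \<alpha>))"
proof -
  have "uniformly_continuous_on {s..h} g"
    using cont by (simp add: compact_uniformly_continuous)
  then obtain d where d: "d > 0"
      "\<And>x y. x \<in> {s..h} \<Longrightarrow> y \<in> {s..h} \<Longrightarrow> dist y x < d \<Longrightarrow> dist (g y) (g x) < e"
    using e_pos by (metis uniformly_continuous_on_def)
  obtain n :: nat where "(h - s) / d \<le> real n"
    using real_arch_simple by blast
  then have "h - s \<le> real n * d" using d by (simp add: field_simps)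
  then show ?thesis
    using \<open>s \<le> h\<close> T cont G d(2)
  proof (induction n arbitrary: s \<theta>)
    case stage: (0 s \<theta>)
    then have "h = s" by simp
    have "track g a s \<theta> s (move g a s \<theta> s)"
      using e_pos by (intro track.last) auto
    moreover have "move g a s \<theta> s = \<theta>" by (simp add: move_def)
    moreover have "\<exists>\<alpha>. T (a + e) (g s) \<theta> \<alpha>"
      using stage(3) T_mono e_pos by (meson less_add_same_cancel1 less_imp_le)
    ultimately show ?case using \<open>h = s\<close> by (intro exI[of _ "\<lambda>_. \<theta>"]) auto
  next
    case (Suc n s \<theta>)
    define \<alpha> where "\<alpha> = target a (g s) \<theta>"
    have Ta: "T a (g s) \<theta> \<alpha>"
      unfolding \<alpha>_def target_def using Suc.prems(3) by (rule someI_ex)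
    let ?m = "move g a s \<theta>"
    have contm: "continuous_on {s..h} ?m"
      unfolding move_def by (intro continuous_intros Suc.prems) (use e_pos in auto)
    have ms: "?m s = \<theta>" by (simp add: move_def)
    have seg: "?m t \<in> closed_segment \<theta> \<alpha>" if "dist (g s) (g t) \<le> e" for t
    proof -
      have "?m t = (1 - dist (g s) (g t) / e) *\<^sub>R \<theta> + (dist (g s) (g t) / e) *\<^sub>R \<alpha>"
        by (simp add: move_def \<alpha>_def algebra_simps)
      moreover have "0 \<le> dist (g s) (g t) / e" "dist (g s) (g t) / e \<le> 1"
        using that e_pos by auto
      ultimately show ?thesis unfolding closed_segment_def by blast
    qed
    have Tm: "T (a + e) (g t) (?m t) \<alpha>" if "dist (g s) (g t) \<le> e" for t
      using T_shift[OF Ta that seg[OF that]] .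
    show ?case
    proof (cases "\<forall>r\<in>{s..h}. dist (g s) (g r) < e")
      case True
      then have "track g a s \<theta> t (?m t)" "T (a + e) (g t) (?m t) \<alpha>" if "t \<in> {s..h}" for t
        using that by (simp_all add: track.last Tm less_imp_le)
      then show ?thesis using contm ms by blast
    next
      case False
      then obtain r where r: "r \<in> {s..h}" "dist (g s) (g r) = e" "\<forall>r'\<in>{s..<r}. dist (g s) (g r') < e"
        using first_exit[OF Suc.prems(4)] by (metis not_le)
      have "d \<le> r - s"
        using Suc.prems(6)[of s r] r Suc.prems(2) by (fastforce simp: dist_real_def dist_commute)
      then have "h - r \<le> real n * d" using Suc.prems(1) by (simp add: algebra_simps)
      \<comment> \<open>On arrival the consumed slack is \<open>a + e\<close>, at most
        \<open>2 * e\<close> because \<open>a \<le> e\<close>. The fresh target resets it to 0, and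
        monotonicity gives back the \<open>a\<close> of the induction hypothesis.\<close>
      moreover have "T (2 * e) (g r) \<alpha> \<alpha>"
        using T_mono[OF T_shift[OF Ta, of "g r" \<alpha>], of "2 * e"] r a by auto
      then have "\<exists>\<beta>. T a (g r) \<alpha> \<beta>"
        using T_fresh Suc.prems(5) r T_mono a by meson
      moreover have "continuous_on {r..h} g"
        using Suc.prems(4) r by (auto intro: continuous_on_subset)
      ultimately have "\<exists>S. continuous_on {r..h} S \<and> S r = \<alpha> \<and>
          (\<forall>t\<in>{r..h}. track g a r \<alpha> t (S t) \<and> (\<exists>\<alpha>. T (a + e) (g t) (S t) \<alpha>))"
        by (intro Suc.IH) (use r Suc.prems(5,6) in auto)
      then obtain S where S: "continuous_on {r..h} S" "S r = \<alpha>"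
        "\<And>t. t \<in> {r..h} \<Longrightarrow> track g a r \<alpha> t (S t)" "\<And>t. t \<in> {r..h} \<Longrightarrow> \<exists>\<alpha>. T (a + e) (g t) (S t) \<alpha>"
        by blast
      let ?S = "\<lambda>t. if t \<le> r then ?m t else S t"
      have mr: "?m r = \<alpha>" using r e_pos by (simp add: move_def \<alpha>_def)
      have "continuous_on ({s..r} \<union> {r..h}) ?S"
        using r contm S mr
        by (intro continuous_on_If) (auto intro: continuous_on_subset)
      moreover have "{s..r} \<union> {r..h} = {s..h}" using r by auto
      moreover have "track g a s \<theta> t (?S t)" if "t \<in> {s..h}" for t
      proof (cases "t < r")
        case True
        then have "track g a s \<theta> t (?m t)"
          using r(3) that by (intro track.last) auto
        then show ?thesis using True by simp
      next
        case False
        then have "?S t = S t" using S(2) mr by auto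
        moreover have "track g a s \<theta> t (S t)"
        proof (rule track.turn[OF _ r(2,3)])
          show "r \<in> {s..t}" using False r(1) by simp
          show "track g a r (target a (g s) \<theta>) t (S t)"
            using False that S(3)[of t] unfolding \<alpha>_def by simp
        qed
        ultimately show ?thesis by simp
      qed
      moreover have "\<exists>\<alpha>. T (a + e) (g t) (?S t) \<alpha>" if "t \<in> {s..h}" for t
      proof (cases "t \<le> r")
        case True
        then have "dist (g s) (g t) \<le> e" using r that by (cases "t = r") (auto intro: less_imp_le)
        then show ?thesis using Tm True by auto
      next
        case False
        then show ?thesis using that S(4)[of t] by auto
      qed
      moreover have "?S s = \<theta>" using ms r by simp
      ultimately show ?thesis by (intro exI[of _ ?S]) auto
    qed
  qed
qed

definition trk :: "(real \<Rightarrow> 'y) \<Rightarrow> real \<Rightarrow> real \<Rightarrow> real \<Rightarrow> real \<Rightarrow> real" where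
  "trk g a s \<theta> t = (THE x. track g a s \<theta> t x)"

lemma trk_cong:
  assumes "\<And>r. r \<in> {s..t} \<Longrightarrow> g r = g' r"
  shows "trk g a s \<theta> t = trk g' a s \<theta> t"
proof -
  have "track g a s \<theta> t x \<longleftrightarrow> track g' a s \<theta> t x" for x
    using track_cong[of g a s \<theta> t x g'] track_cong[of g' a s \<theta> t x g] assms by auto
  then show ?thesis by (simp add: trk_def)
qed

lemma trk_refl [simp]: "trk g a s \<theta> s = \<theta>"
proof -
  have "track g a s \<theta> s (move g a s \<theta> s)"
    using e_pos by (intro track.last) auto
  moreover have "move g a s \<theta> s = \<theta>" by (simp add: move_def)
  ultimately show ?thesis unfolding trk_def using track_unique by (metis the_equality)
qed

lemma trk_props:
  assumes "continuous_on {s..h} g" "\<And>r. r \<in> {s..h} \<Longrightarrow> g r \<in> G" "s \<le> h"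
    and "0 \<le> a" "a \<le> e" "\<exists>\<alpha>. T a (g s) \<theta> \<alpha>"
  shows "continuous_on {s..h} (trk g a s \<theta>)"
    and "t \<in> {s..h} \<Longrightarrow> \<exists>\<alpha>. T (a + e) (g t) (trk g a s \<theta> t) \<alpha>"
proof -
  obtain S where S: "continuous_on {s..h} S"
    "\<forall>t\<in>{s..h}. track g a s \<theta> t (S t) \<and> (\<exists>\<alpha>. T (a + e) (g t) (S t) \<alpha>)"
    using track_exists[OF assms] by blast
  have "trk g a s \<theta> t = S t" if "t \<in> {s..h}" for t
    unfolding trk_def using S that track_unique by (metis the_equality)
  then show "continuous_on {s..h} (trk g a s \<theta>)"
    "t \<in> {s..h} \<Longrightarrow> \<exists>\<alpha>. T (a + e) (g t) (trk g a s \<theta> t) \<alpha>"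
    using S continuous_on_cong[of "{s..h}" "{s..h}" "trk g a s \<theta>" S] by auto
qed

end

section \<open>Tracking along paths that can be normalised only part of the time\<close>

locale tracking_paths = tracking T e G
  for T :: "real \<Rightarrow> 'y::metric_space \<Rightarrow> real \<Rightarrow> real \<Rightarrow> bool" and e G +
  fixes Pos V :: "'z::t2_space set" and N :: "'z \<Rightarrow> 'y"
  assumes cont_N: "continuous_on Pos N" and N_G: "z \<in> Pos \<Longrightarrow> z \<in> V \<Longrightarrow> N z \<in> G"
begin

text \<open>\<open>V\<close> holds the legal input values, \<open>Pos\<close> those that
  \<open>N\<close> can normalise. A path may leave \<open>Pos\<close> and return; each stay in
  \<open>Pos\<close> is solved on its own.\<close>

definition admissible :: "(real \<Rightarrow> 'z) \<Rightarrow> bool" where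
  "admissible u \<longleftrightarrow> continuous_on UNIV u \<and> range u \<subseteq> V"

text \<open>The predicate under \<open>SOME\<close> is the same for all \<open>t\<close> in one
  component of the times in \<open>Pos\<close>, so the choice yields one base point per
  component.\<close>

definition base :: "(real \<Rightarrow> 'z) \<Rightarrow> real \<Rightarrow> real" where
  "base v t = (SOME s. closed_segment s t \<subseteq> v -` Pos)"

definition init :: "'z \<Rightarrow> real" where
  "init z = (SOME \<theta>. \<exists>\<alpha>. T 0 (N z) \<theta> \<alpha>)"

text \<open>A solution on a whole component of the set of times at which \<open>v\<close> lies in \<open>Pos\<close>.  It tracks forwards
  and backwards from a base point of the component, so it is not causal.\<close>

definition free :: "(real \<Rightarrow> 'z) \<Rightarrow> real \<Rightarrow> real" where
  "free v t = (let s = base v t in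
     if s \<le> t then trk (\<lambda>r. N (v r)) 0 s (init (v s)) t
     else trk (\<lambda>r. N (v (- r))) 0 (- s) (init (v s)) (- t))"

lemma base_const:
  assumes "closed_segment t t' \<subseteq> v -` Pos"
  shows "base v t = base v t'"
proof -
  have "closed_segment s t \<subseteq> closed_segment s t' \<union> closed_segment t t'"
    "closed_segment s t' \<subseteq> closed_segment s t \<union> closed_segment t t'" for s
    by (auto simp: closed_segment_eq_real_ivl split: if_splits)
  then have "closed_segment s t \<subseteq> v -` Pos \<longleftrightarrow> closed_segment s t' \<subseteq> v -` Pos" for s
    using assms by blast
  then show ?thesis by (simp add: base_def)
qed

lemma cont_N_path:
  assumes "admissible v" "S \<subseteq> v -` Pos"
  shows "continuous_on S (\<lambda>r. N (v r))"
proof (rule continuous_on_compose2[OF cont_N])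
  show "continuous_on S v" using assms by (auto simp: admissible_def intro: continuous_on_subset)
qed (use assms in auto)

lemma N_path_in_G: "admissible v \<Longrightarrow> v r \<in> Pos \<Longrightarrow> N (v r) \<in> G"
  by (rule N_G) (auto simp: admissible_def)

lemma admissible_reverse: "admissible v \<Longrightarrow> admissible (\<lambda>r. v (- r))"
  unfolding admissible_def by (auto intro!: continuous_on_compose2[of UNIV v] continuous_intros)

lemma free_props:
  assumes v: "admissible v" and "l \<le> h" and sub: "{l..h} \<subseteq> v -` Pos"
  shows "continuous_on {l..h} (free v)"
    and "t \<in> {l..h} \<Longrightarrow> \<exists>\<alpha>. T e (N (v t)) (free v t) \<alpha>"
proof -
  define s where "s = base v l"
  have "closed_segment l l \<subseteq> v -` Pos" using assms by auto
  then have s: "closed_segment s l \<subseteq> v -` Pos"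
    unfolding s_def base_def by (rule someI)
  have bs: "base v t = s" if "t \<in> {l..h}" for t
    unfolding s_def
    by (rule base_const) (use sub that in \<open>auto simp: closed_segment_eq_real_ivl split: if_splits\<close>)
  \<comment> \<open>The base point may lie outside \<open>{l..h}\<close>. The interval is enlarged
    to contain it, which does not leave the component.\<close>
  define l' where "l' = min l s"
  define h' where "h' = max h s"
  have sub': "{l'..h'} \<subseteq> v -` Pos"
  proof
    fix x assume "x \<in> {l'..h'}"
    then have "x \<in> {l..h} \<or> x \<in> closed_segment s l"
      by (auto simp: l'_def h'_def closed_segment_eq_real_ivl min_def max_def split: if_splits)
    then show "x \<in> v -` Pos" using s sub by auto
  qed
  have lsh: "l' \<le> s" "s \<le> h'" by (auto simp: l'_def h'_def)
  define \<theta> where "\<theta> = init (v s)"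
  have "v s \<in> Pos" using sub' lsh by auto
  have "\<exists>\<theta>. \<exists>\<alpha>. T 0 (N (v s)) \<theta> \<alpha>"
    using T_init N_path_in_G[OF v \<open>v s \<in> Pos\<close>] by blast
  then have \<theta>: "\<exists>\<alpha>. T 0 (N (v s)) \<theta> \<alpha>"
    unfolding \<theta>_def init_def by (rule someI_ex)
  let ?F = "trk (\<lambda>r. N (v r)) 0 s \<theta>"
  let ?B = "trk (\<lambda>r. N (v (- r))) 0 (- s) \<theta>"
  have F: "continuous_on {s..h'} ?F" "\<And>t. t \<in> {s..h'} \<Longrightarrow> \<exists>\<alpha>. T e (N (v t)) (?F t) \<alpha>"
    using trk_props[of s h' "\<lambda>r. N (v r)" 0 \<theta>] lsh sub' \<theta> e_pos N_path_in_G[OF v]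
      cont_N_path[OF v, of "{s..h'}"]
    by (auto simp: subset_iff)
  have B: "continuous_on {-s..-l'} ?B" "\<And>t. t \<in> {-s..-l'} \<Longrightarrow> \<exists>\<alpha>. T e (N (v (- t))) (?B t) \<alpha>"
    using trk_props[of "-s" "-l'" "\<lambda>r. N (v (- r))" 0 \<theta>] lsh sub' \<theta> e_pos N_path_in_G[OF v]
      cont_N_path[OF admissible_reverse[OF v], of "{-s..-l'}"]
    by (auto simp: subset_iff)
  have "continuous_on {l'..s} (\<lambda>t. ?B (- t))"
    by (rule continuous_on_compose2[OF B(1)]) (auto intro!: continuous_intros)
  then have "continuous_on ({s..h'} \<union> {l'..s}) (\<lambda>t. if s \<le> t then ?F t else ?B (- t))"
    using F(1) by (intro continuous_on_If) auto
  moreover have "{l..h} \<subseteq> {s..h'} \<union> {l'..s}" by (auto simp: l'_def h'_def)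
  ultimately have "continuous_on {l..h} (\<lambda>t. if s \<le> t then ?F t else ?B (- t))"
    by (rule continuous_on_subset)
  then show "continuous_on {l..h} (free v)"
    by (rule continuous_on_eq) (use bs in \<open>simp add: free_def \<theta>_def\<close>)
  have fr: "free v t = (if s \<le> t then ?F t else ?B (- t))" if "t \<in> {l..h}" for t
    using bs[OF that] by (simp add: free_def \<theta>_def)
  show "\<exists>\<alpha>. T e (N (v t)) (free v t) \<alpha>" if t: "t \<in> {l..h}"
  proof (cases "s \<le> t")
    case True
    then show ?thesis using fr[OF t] F(2)[of t] t by (auto simp: h'_def)
  next
    case False
    then show ?thesis using fr[OF t] B(2)[of "-t"] t by (auto simp: l'_def)
  qed
qed

text \<open>A component of the set of times with \<open>u\<close> in \<open>Pos\<close> has no first time at which tracking could start.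
  Instead, all paths with the same germ at its left end (possibly at minus infinity) share one
  representative path; the output follows the non-causal solution of that representative until
  the actual path diverges from it, and tracks causally from then on.\<close>

definition same_germ :: "(real \<Rightarrow> 'z) \<Rightarrow> real \<Rightarrow> (real \<Rightarrow> 'z) \<Rightarrow> bool" where
  "same_germ u t v \<longleftrightarrow> admissible v \<and> (\<exists>s\<le>t. {s..t} \<subseteq> u -` Pos \<and> (\<forall>r\<le>s. v r = u r))"

definition rep :: "(real \<Rightarrow> 'z) \<Rightarrow> real \<Rightarrow> real \<Rightarrow> 'z" where
  "rep u t = (SOME v. same_germ u t v)"

text \<open>Truncation at \<open>t\<close> keeps the value causal. While \<open>u\<close> and
  \<open>v\<close> agree up to \<open>t\<close> it equals \<open>t\<close>, and then
  \<open>out\<close> is just \<open>free v t\<close>.\<close>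

definition divergence :: "(real \<Rightarrow> 'z) \<Rightarrow> (real \<Rightarrow> 'z) \<Rightarrow> real \<Rightarrow> real" where
  "divergence u v t = Sup {s. s \<le> t \<and> (\<forall>r\<le>s. v r = u r)}"

text \<open>Causal tracking starts with slack \<open>e\<close> already consumed, since that is what
  \<open>free\<close> may have spent by the time of divergence.\<close>

definition out :: "(real \<Rightarrow> 'z) \<Rightarrow> real \<Rightarrow> real" where
  "out u t = (let v = rep u t; d = divergence u v t
     in trk (\<lambda>r. N (u r)) e d (free v d) t)"

text \<open>Agreement up to some time implies agreement up to every earlier one, so all times of a
  component admit the same candidates \<open>v\<close>, and \<open>SOME\<close> makes the same
  choice for them.\<close>

lemma rep_const:
  assumes "l \<le> h" "{l..h} \<subseteq> u -` Pos" "t \<in> {l..h}"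
  shows "rep u t = rep u h"
proof -
  have "same_germ u t v \<longleftrightarrow> same_germ u h v" for v
  proof
    assume "same_germ u t v"
    then obtain s where s: "admissible v" "s \<le> t" "{s..t} \<subseteq> u -` Pos" "\<forall>r\<le>s. v r = u r"
      by (auto simp: same_germ_def)
    have "{s..h} \<subseteq> {s..t} \<union> {l..h}" using assms by auto
    then have "{s..h} \<subseteq> u -` Pos" using s assms by blast
    then show "same_germ u h v" using s assms by (auto simp: same_germ_def intro!: exI[of _ s])
  next
    assume "same_germ u h v"
    then obtain s where s: "admissible v" "s \<le> h" "{s..h} \<subseteq> u -` Pos" "\<forall>r\<le>s. v r = u r"
      by (auto simp: same_germ_def)
    have "{min s t..t} \<subseteq> {s..h} \<union> {l..h}" using assms by (auto simp: min_def)
    then have "{min s t..t} \<subseteq> u -` Pos" using s assms by blast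
    then show "same_germ u t v" using s assms by (auto simp: same_germ_def intro!: exI[of _ "min s t"])
  qed
  then show ?thesis by (simp add: rep_def)
qed

lemma divergence_props:
  assumes "continuous_on UNIV u" "continuous_on UNIV v" "s \<le> t" "\<forall>r\<le>s. v r = u r"
  shows "s \<le> divergence u v t" "divergence u v t \<le> t" "\<forall>r\<le>divergence u v t. v r = u r"
proof -
  let ?X = "{s. s \<le> t \<and> (\<forall>r\<le>s. v r = u r)}"
  have bdd: "bdd_above ?X" by (auto intro: bdd_aboveI[of _ t])
  have sX: "s \<in> ?X" using assms by auto
  show "s \<le> divergence u v t"
    unfolding divergence_def by (rule cSup_upper[OF sX bdd])
  show "divergence u v t \<le> t"
    unfolding divergence_def by (rule cSup_least) (use sX in blast)+
  have less: "v r = u r" if "r < divergence u v t" for r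
  proof -
    have "\<exists>x\<in>?X. r < x"
      by (rule less_cSupD) (use that sX in \<open>auto simp only: divergence_def\<close>)
    then show ?thesis using less_imp_le by blast
  qed
  \<comment> \<open>The supremum is attained: two continuous paths agree on a closed set.\<close>
  have "closed {r. v r = u r}"
    by (rule closed_Collect_eq[OF assms(2,1)])
  moreover have "{..<divergence u v t} \<subseteq> {r. v r = u r}" using less by auto
  ultimately have "closure {..<divergence u v t} \<subseteq> {r. v r = u r}"
    by (rule closure_minimal[rotated])
  then show "\<forall>r\<le>divergence u v t. v r = u r" by auto
qed

text \<open>With this, \<open>out\<close> on an interval has a single switching time, seen from each
  earlier \<open>t\<close> as cut off at \<open>t\<close>.\<close>

lemma divergence_min:
  assumes "continuous_on UNIV u" "continuous_on UNIV v" "s \<le> t" "t \<le> h" "\<forall>r\<le>s. v r = u r"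
  shows "divergence u v t = min t (divergence u v h)"
proof (rule antisym)
  note Dt = divergence_props[OF assms(1,2,3,5)]
  have "s \<le> h" using assms by simp
  note Dh = divergence_props[OF assms(1,2) this assms(5)]
  have "divergence u v t \<le> divergence u v h"
    using divergence_props(1)[OF assms(1,2), of "divergence u v t" h] Dt assms by auto
  then show "divergence u v t \<le> min t (divergence u v h)" using Dt by auto
  show "min t (divergence u v h) \<le> divergence u v t"
    using divergence_props(1)[OF assms(1,2), of "min t (divergence u v h)" t] Dh by auto
qed

text \<open>One representative and one divergence time \<open>D\<close> serve the whole interval. Up
  to \<open>D\<close> the output is \<open>free\<close> with slack at most \<open>e\<close>; after
  \<open>D\<close> causal tracking raises the slack from \<open>e\<close> to at most
  \<open>2 * e\<close>. Both pieces agree at \<open>D\<close>.\<close>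

lemma out_props:
  assumes u: "admissible u" and "l \<le> h" and sub: "{l..h} \<subseteq> u -` Pos"
  shows "continuous_on {l..h} (out u)"
    and "t \<in> {l..h} \<Longrightarrow> \<exists>\<alpha>. T (2 * e) (N (u t)) (out u t) \<alpha>"
proof -
  define v where "v = rep u h"
  have "same_germ u h u" using assms by (auto simp: same_germ_def intro!: exI[of _ h])
  then have "same_germ u h v" unfolding v_def rep_def by (rule someI[of "same_germ u h"])
  then obtain s0 where s0: "admissible v" "s0 \<le> h" "{s0..h} \<subseteq> u -` Pos" "\<forall>r\<le>s0. v r = u r"
    by (auto simp: same_germ_def)
  define s where "s = min s0 l"
  have "{s..h} \<subseteq> {s0..h} \<union> {l..h}" by (auto simp: s_def min_def)
  then have s: "s \<le> l" "{s..h} \<subseteq> u -` Pos" "\<forall>r\<le>s. v r = u r"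
    using s0 sub by (auto simp: s_def)
  have cu: "continuous_on UNIV u" and cv: "continuous_on UNIV v"
    using u s0 by (auto simp: admissible_def)
  define D where "D = divergence u v h"
  have "s \<le> h" using s assms by simp
  note D = divergence_props[OF cu cv this s(3), folded D_def]
  have subv: "{s..D} \<subseteq> v -` Pos" using D s by (auto simp: subset_iff)
  note fr = free_props[OF s0(1) D(1) subv]
  have "u D = v D" using D by simp
  then have "\<exists>\<alpha>. T e (N (u D)) (free v D) \<alpha>" using fr(2)[of D] D by auto
  moreover have "{D..h} \<subseteq> u -` Pos" using D s by auto
  moreover have "continuous_on {D..h} (\<lambda>r. N (u r))" by (rule cont_N_path[OF u]) fact
  ultimately have tr: "continuous_on {D..h} (trk (\<lambda>r. N (u r)) e D (free v D))"
    "\<And>t. t \<in> {D..h} \<Longrightarrow> \<exists>\<alpha>. T (2 * e) (N (u t)) (trk (\<lambda>r. N (u r)) e D (free v D) t) \<alpha>"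
    using trk_props[of D h "\<lambda>r. N (u r)" e "free v D"] D e_pos N_path_in_G[OF u]
    by (auto simp: subset_iff)
  let ?o = "\<lambda>t. if t \<le> D then free v t else trk (\<lambda>r. N (u r)) e D (free v D) t"
  have o: "out u t = ?o t" if t: "t \<in> {s..h}" for t
  proof -
    have "rep u t = v" unfolding v_def using rep_const[OF _ s(2) t] s assms by simp
    moreover have "divergence u v t = min t D"
      unfolding D_def using t s by (intro divergence_min cu cv) auto
    ultimately show ?thesis by (auto simp: out_def min_def)
  qed
  have "continuous_on ({s..D} \<union> {D..h}) ?o"
    using fr(1) tr(1) by (intro continuous_on_If) auto
  moreover have "{s..D} \<union> {D..h} = {s..h}" using D by auto
  ultimately have "continuous_on {s..h} ?o" by simp
  then have "continuous_on {s..h} (out u)"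
    by (rule continuous_on_eq) (use o in simp)
  then show "continuous_on {l..h} (out u)" by (rule continuous_on_subset) (use s in auto)
  show "\<exists>\<alpha>. T (2 * e) (N (u t)) (out u t) \<alpha>" if "t \<in> {l..h}"
  proof (cases "t \<le> D")
    case True
    then have "\<exists>\<alpha>. T e (N (u t)) (free v t) \<alpha>" using fr(2)[of t] that s D by auto
    then show ?thesis using o[of t] that True s T_mono e_pos
      by (smt (verit, ccfv_threshold) atLeastAtMost_iff)
  next
    case False
    then show ?thesis using o[of t] tr(2)[of t] that s by auto
  qed
qed

text \<open>\<open>free v\<close> may look at the future of \<open>v\<close>, but \<open>v\<close>
  itself is chosen from the past of \<open>u\<close> alone. This is why the non-causal solution does
  no harm.\<close>

lemma out_cong:
  assumes "\<And>r. r \<le> t \<Longrightarrow> u r = u' r" and u: "admissible u" and "u t \<in> Pos"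
  shows "out u t = out u' t"
proof -
  have "same_germ u t v \<longleftrightarrow> same_germ u' t v" for v
  proof -
    have "{s..t} \<subseteq> u -` Pos \<and> (\<forall>r\<le>s. v r = u r) \<longleftrightarrow> {s..t} \<subseteq> u' -` Pos \<and> (\<forall>r\<le>s. v r = u' r)" if "s \<le> t" for s
      using that assms by (auto simp: subset_iff)
    then show ?thesis unfolding same_germ_def by blast
  qed
  then have rep: "rep u t = rep u' t" by (simp add: rep_def)
  define v where "v = rep u t"
  have "{s. s \<le> t \<and> (\<forall>r\<le>s. v r = u r)} = {s. s \<le> t \<and> (\<forall>r\<le>s. v r = u' r)}"
    using assms by auto
  then have d: "divergence u v t = divergence u' v t" by (simp add: divergence_def)
  have "trk (\<lambda>r. N (u r)) e d \<theta> t = trk (\<lambda>r. N (u' r)) e d \<theta> t" for d \<theta>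
    by (rule trk_cong) (use assms in auto)
  then show ?thesis using rep d by (simp add: out_def v_def)
qed

end

section \<open>Lifting from the circle and periodic cost functions\<close>

lemma cis_eq_iff: "cis x = cis y \<longleftrightarrow> (\<exists>k::int. x = y + 2 * pi * of_int k)"
proof
  assume "cis x = cis y"
  then have "cis (x - y) = 1"
    by (simp flip: cis_divide)
  then have "cos (x - y) = 1" by (metis cis.simps(1) one_complex.simps(1))
  then show "\<exists>k::int. x = y + 2 * pi * of_int k"
    by (auto simp: cos_one_2pi_int algebra_simps)
next
  assume "\<exists>k::int. x = y + 2 * pi * of_int k"
  then show "cis x = cis y" by (auto simp flip: cis_mult)
qed

text \<open>Pinning the value at time 0 removes the freedom of a multiple of \<open>2 * pi\<close>,
  so that the lift at \<open>t\<close> depends only on \<open>w\<close> over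
  \<open>{0..t}\<close>.\<close>

definition circle_lift :: "(real \<Rightarrow> complex) \<Rightarrow> real \<Rightarrow> real" where
  "circle_lift w = (SOME \<phi>. continuous_on UNIV \<phi> \<and> (\<forall>t. cis (\<phi> t) = w t) \<and> \<phi> 0 = Arg (w 0))"

lemma circle_lift:
  assumes "continuous_on UNIV w" "\<And>t. norm (w t) = 1"
  shows "continuous_on UNIV (circle_lift w)" "cis (circle_lift w t) = w t" "circle_lift w 0 = Arg (w 0)"
proof -
  have nz: "w z \<noteq> 0" for z using assms(2)[of z] by auto
  obtain g where g: "continuous_on UNIV g" "\<And>x. w x = exp (g x)"
    using continuous_logarithm_on_contractible[of UNIV w] assms(1) nz
    by (metis UNIV_I contractible_UNIV)
  have Re: "Re (g x) = 0" for x
    using assms(2)[of x] g(2)[of x] by simp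
  have w: "w x = cis (Im (g x))" for x
    using g(2)[of x] Re[of x] by (simp add: exp_eq_polar)
  \<comment> \<open>The subtracted constant is a multiple of \<open>2 * pi\<close>; it moves the
    lift onto the prescribed initial value.\<close>
  define \<phi> where "\<phi> x = Im (g x) - (Im (g 0) - Arg (w 0))" for x
  have "cis (Im (g 0)) = cis (Arg (w 0))"
    using w[of 0] assms(2)[of 0] nz[of 0] by (simp add: cis_Arg sgn_div_norm)
  then have "cis (\<phi> x) = w x" for x
    by (simp add: \<phi>_def w flip: cis_divide)
  moreover have "continuous_on UNIV \<phi>" unfolding \<phi>_def by (intro continuous_intros g)
  moreover have "\<phi> 0 = Arg (w 0)" by (simp add: \<phi>_def)
  ultimately have "\<exists>\<phi>. continuous_on UNIV \<phi> \<and> (\<forall>t. cis (\<phi> t) = w t) \<and> \<phi> 0 = Arg (w 0)"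
    by blast
  from someI_ex[OF this]
  show "continuous_on UNIV (circle_lift w)" "cis (circle_lift w t) = w t" "circle_lift w 0 = Arg (w 0)"
    unfolding circle_lift_def by blast+
qed

text \<open>The difference of the two lifts is continuous with values in the multiples of
  \<open>2 * pi\<close>, hence constant, and it vanishes at 0.\<close>

lemma circle_lift_cong:
  assumes "continuous_on UNIV w" "\<And>t. norm (w t) = 1" "continuous_on UNIV w'" "\<And>t. norm (w' t) = 1"
    and "0 \<le> t" "\<And>r. r \<in> {0..t} \<Longrightarrow> w r = w' r"
  shows "circle_lift w t = circle_lift w' t"
proof -
  note L = circle_lift[OF assms(1,2)] and L' = circle_lift[OF assms(3,4)]
  define d where "d r = circle_lift w r - circle_lift w' r" for r
  have k: "\<exists>k::int. d r = 2 * pi * of_int k" if "r \<in> {0..t}" for r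
  proof -
    have "cis (circle_lift w r) = cis (circle_lift w' r)"
      using that assms(6) L(2) L'(2) by simp
    then show ?thesis unfolding d_def cis_eq_iff by auto
  qed
  have "d constant_on {0..t}"
  proof (rule continuous_discrete_range_constant)
    show "continuous_on {0..t} d" unfolding d_def
      by (intro continuous_intros continuous_on_subset[OF L(1)] continuous_on_subset[OF L'(1)]) auto
    fix x assume x: "x \<in> {0..t}"
    have "2 * pi \<le> norm (d y - d x)" if y: "y \<in> {0..t}" "d y \<noteq> d x" for y
    proof -
      obtain j k :: int where jk: "d y = 2 * pi * of_int j" "d x = 2 * pi * of_int k"
        using k x y by blast
      then have "j \<noteq> k" using y by auto
      then have "1 \<le> \<bar>real_of_int (j - k)\<bar>" by linarith
      moreover have "norm (d y - d x) = 2 * pi * \<bar>real_of_int (j - k)\<bar>"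
        using jk by (simp add: abs_mult flip: right_diff_distrib)
      ultimately show ?thesis by (simp add: mult_le_cancel_left1)
    qed
    then show "\<exists>e>0. \<forall>y. y \<in> {0..t} \<and> d y \<noteq> d x \<longrightarrow> e \<le> norm (d y - d x)"
      by (intro exI[of _ "2 * pi"]) auto
  qed auto
  moreover have "d 0 = 0" using L(3) L'(3) assms(5) assms(6)[of 0] by (simp add: d_def)
  ultimately have "d t = 0" using assms(5) unfolding constant_on_def by fastforce
  then show ?thesis by (simp add: d_def)
qed

section \<open>Angular costs in the space of bounded continuous functions\<close>

definition min_value :: "(real \<Rightarrow>\<^sub>C real) \<Rightarrow> real" where
  "min_value y = (INF \<theta>. apply_bcontfun y \<theta>)"

lemma bdd_below_bcontfun: "bdd_below (range (apply_bcontfun (y :: 'a::topological_space \<Rightarrow>\<^sub>C real)))"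
  using norm_bounded[of y] by (intro bdd_belowI2[of _ "- norm y"]) (simp add: abs_le_iff minus_le_iff)

lemma min_value_le: "min_value y \<le> apply_bcontfun y \<theta>"
  unfolding min_value_def by (rule cINF_lower[OF bdd_below_bcontfun]) simp

lemma abs_bcontfun_diff_le: "\<bar>apply_bcontfun y \<theta> - apply_bcontfun z \<theta>\<bar> \<le> dist y (z :: 'a::topological_space \<Rightarrow>\<^sub>C real)"
  using dist_bounded[of y \<theta> z] by (simp add: dist_real_def)

lemma continuous_on_min_value: "continuous_on S min_value"
proof -
  have le: "min_value y \<le> min_value z + dist y z" for y z
  proof -
    have "min_value y - dist y z \<le> apply_bcontfun z \<theta>" for \<theta>
      using min_value_le[of y \<theta>] abs_bcontfun_diff_le[of y \<theta> z] by linarith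
    then show ?thesis unfolding min_value_def[of z]
      by (metis cINF_greatest UNIV_not_empty diff_le_eq)
  qed
  have "dist (min_value y) (min_value z) \<le> dist y z" for y z
    using le[of y z] le[of z y] by (simp add: dist_real_def dist_commute)
  then show ?thesis
    unfolding continuous_on_iff by (metis order.strict_trans1)
qed

text \<open>Cost functions of an angle for which any two angles of cost at most \<open>K\<close> are joined, modulo the
  period, by an interval of cost at most \<open>c * K\<close>.\<close>

definition joined_costs :: "real \<Rightarrow> real \<Rightarrow> (real \<Rightarrow>\<^sub>C real) set" where
  "joined_costs \<omega> c = {y. (\<forall>\<theta>. 0 \<le> apply_bcontfun y \<theta>) \<and>
     (\<forall>\<theta>. apply_bcontfun y (\<theta> + \<omega>) = apply_bcontfun y \<theta>) \<and>
     (\<forall>K \<alpha> \<beta>. apply_bcontfun y \<alpha> \<le> K \<longrightarrow> apply_bcontfun y \<beta> \<le> K \<longrightarrow>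
        (\<exists>k::int. \<forall>w\<in>closed_segment \<alpha> (\<beta> + of_int k * \<omega>). apply_bcontfun y w \<le> c * K)) \<and>
     (\<forall>\<alpha> \<beta>. apply_bcontfun y \<alpha> = 0 \<longrightarrow> apply_bcontfun y \<beta> = 0 \<longrightarrow> (\<exists>k::int. \<beta> = \<alpha> + of_int k * \<omega>))}"

lemma periodic_int:
  fixes f :: "real \<Rightarrow> 'a"
  assumes "\<And>\<theta>. f (\<theta> + \<omega>) = f \<theta>"
  shows "f (\<theta> + of_int k * \<omega>) = f \<theta>"
proof (induction k rule: int_induct[where k = 0])
  case (step1 i)
  then show ?case using assms[of "\<theta> + of_int i * \<omega>"] by (simp add: algebra_simps)
next
  case (step2 i)
  then show ?case using assms[of "\<theta> + of_int (i - 1) * \<omega>"] by (simp add: algebra_simps)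
qed simp

lemma joined_costsD:
  assumes "y \<in> joined_costs \<omega> c"
  shows "0 \<le> apply_bcontfun y \<theta>"
    and "apply_bcontfun y (\<theta> + of_int k * \<omega>) = apply_bcontfun y \<theta>"
    and "apply_bcontfun y \<alpha> \<le> K \<Longrightarrow> apply_bcontfun y \<beta> \<le> K \<Longrightarrow>
        \<exists>k::int. \<forall>w\<in>closed_segment \<alpha> (\<beta> + of_int k * \<omega>). apply_bcontfun y w \<le> c * K"
    and "apply_bcontfun y \<alpha> = 0 \<Longrightarrow> apply_bcontfun y \<beta> = 0 \<Longrightarrow> \<exists>k::int. \<beta> = \<alpha> + of_int k * \<omega>"
  using assms periodic_int[of "apply_bcontfun y" \<omega>] unfolding joined_costs_def by auto

lemma reduce_mod_period:
  assumes "0 < (\<omega>::real)"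
  shows "\<exists>k::int. \<theta> + of_int k * \<omega> \<in> {0..\<omega>}"
proof -
  have "of_int \<lfloor>\<theta> / \<omega>\<rfloor> * \<omega> \<le> \<theta>" "\<theta> \<le> (of_int \<lfloor>\<theta> / \<omega>\<rfloor> + 1) * \<omega>"
    using floor_divide_lower[OF assms, of \<theta>] floor_divide_upper[OF assms, of \<theta>] by simp_all
  then show ?thesis
    by (intro exI[of _ "- \<lfloor>\<theta> / \<omega>\<rfloor>"]) (simp add: algebra_simps)
qed

lemma min_value_attained:
  assumes "0 < \<omega>" "\<And>\<theta>. apply_bcontfun y (\<theta> + \<omega>) = apply_bcontfun y \<theta>"
  shows "\<exists>\<theta>. apply_bcontfun y \<theta> = min_value y"
proof -
  obtain x where x: "x \<in> {0..\<omega>}" "\<And>z. z \<in> {0..\<omega>} \<Longrightarrow> apply_bcontfun y x \<le> apply_bcontfun y z"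
    using continuous_attains_inf[of "{0..\<omega>}" "apply_bcontfun y"] assms(1) by fastforce
  have "apply_bcontfun y x \<le> apply_bcontfun y z" for z
    using reduce_mod_period[OF assms(1), of z] x(2) periodic_int[of "apply_bcontfun y" \<omega>, OF assms(2)]
    by metis
  then have "apply_bcontfun y x \<le> min_value y"
    unfolding min_value_def by (intro cINF_greatest) auto
  then show ?thesis using min_value_le[of y x] by (metis antisym)
qed

text \<open>Agreement is asked on the whole ray up to \<open>t\<close>, negative times included,
  because the choice of a germ may look back to minus infinity. The restriction to
  \<open>0 \<le> t\<close> comes from the lift, which is pinned at time 0.\<close>

definition causal_selector :: "real \<Rightarrow> real \<Rightarrow> real \<Rightarrow> ((real \<Rightarrow> real \<Rightarrow>\<^sub>C real) \<Rightarrow> real \<Rightarrow> real) \<Rightarrow> bool" where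
  "causal_selector \<omega> c0 c G \<longleftrightarrow>
     (\<forall>u. continuous_on UNIV u \<and> range u \<subseteq> joined_costs \<omega> c0 \<longrightarrow>
        continuous_on UNIV (G u) \<and> (\<forall>t. apply_bcontfun (u t) (G u t) \<le> c * min_value (u t)) \<and>
        (\<forall>u' t. continuous_on UNIV u' \<and> range u' \<subseteq> joined_costs \<omega> c0 \<and> 0 \<le> t \<and> (\<forall>r\<le>t. u r = u' r) \<longrightarrow>
           G u t = G u' t))"

lemma causal_selectorD:
  assumes "causal_selector \<omega> c0 c G" "continuous_on UNIV u" "range u \<subseteq> joined_costs \<omega> c0"
  shows "continuous_on UNIV (G u)" "apply_bcontfun (u t) (G u t) \<le> c * min_value (u t)"
    and "continuous_on UNIV u' \<Longrightarrow> range u' \<subseteq> joined_costs \<omega> c0 \<Longrightarrow> 0 \<le> t \<Longrightarrow>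
       \<forall>r\<le>t. u r = u' r \<Longrightarrow> G u t = G u' t"
  using assms unfolding causal_selector_def by blast+

lemma causal_selection:
  assumes \<omega>: "0 < \<omega>" and c0: "1 \<le> c0" and c: "c0 < c"
  shows "\<exists>G. causal_selector \<omega> c0 c G"
proof -
  \<comment> \<open>Solves \<open>c0 * (1 + 2 * e) + 2 * e = c\<close>: the inner
    \<open>2 * e\<close> is the excess of a target on arrival, the outer one the drift of the cost
    function during a move.\<close>
  define e where "e = (c - c0) / (2 * (c0 + 1))"
  have "e * (2 * (c0 + 1)) = c - c0" using c0 by (simp add: e_def)
  moreover have "0 < e" using c0 c by (simp add: e_def)
  ultimately have e: "0 < e" "c0 * (1 + 2 * e) + 2 * e = c"
    by (simp_all add: algebra_simps)
  \<comment> \<open>The first bound keeps the target nearly optimal, so that arrival permits a new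
    joining interval; the second is the bound on the ratio along the way.\<close>
  define T :: "real \<Rightarrow> (real \<Rightarrow>\<^sub>C real) \<Rightarrow> real \<Rightarrow> real \<Rightarrow> bool" where
    "T a y \<theta> \<alpha> \<longleftrightarrow> apply_bcontfun y \<alpha> \<le> 1 + a \<and>
       (\<forall>w\<in>closed_segment \<theta> \<alpha>. apply_bcontfun y w \<le> c0 * (1 + 2 * e) + a)" for a y \<theta> \<alpha>
  define G where "G = {y. (\<exists>\<beta>. apply_bcontfun y \<beta> = 1) \<and>
     (\<forall>\<theta>. \<forall>k::int. apply_bcontfun y (\<theta> + of_int k * \<omega>) = apply_bcontfun y \<theta>) \<and>
     (\<forall>K \<alpha> \<beta>. apply_bcontfun y \<alpha> \<le> K \<longrightarrow> apply_bcontfun y \<beta> \<le> K \<longrightarrow>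
        (\<exists>k::int. \<forall>w\<in>closed_segment \<alpha> (\<beta> + of_int k * \<omega>). apply_bcontfun y w \<le> c0 * K))}"
  define Pos where "Pos = {y. 0 < min_value y}"
  define N where "N y = (1 / min_value y) *\<^sub>R y" for y
  have N_apply: "apply_bcontfun (N y) \<theta> = apply_bcontfun y \<theta> / min_value y" for y \<theta>
    by (simp add: N_def scaleR_bcontfun.rep_eq)
  interpret tracking_paths T e G Pos "joined_costs \<omega> c0" N
  proof
    show "0 < e" by (rule e)
    show "T b y \<theta> \<alpha>" if "T a y \<theta> \<alpha>" "a \<le> b" for a b y \<theta> \<alpha>
      using that unfolding T_def by fastforce
    show "T (a + e) y' \<theta>' \<alpha>" if T: "T a y \<theta> \<alpha>" and d: "dist y y' \<le> e" and \<theta>': "\<theta>' \<in> closed_segment \<theta> \<alpha>" for a y y' \<theta> \<theta>' \<alpha>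
    proof -
      have "apply_bcontfun y' w \<le> apply_bcontfun y w + e" for w
        using abs_bcontfun_diff_le[of y w y'] d by linarith
      moreover have "closed_segment \<theta>' \<alpha> \<subseteq> closed_segment \<theta> \<alpha>"
        using \<theta>' by (simp add: subset_closed_segment)
      ultimately show ?thesis using T unfolding T_def by (smt (verit) subsetD)
    qed
    show "\<exists>\<beta>. T 0 y \<alpha> \<beta>" if y: "y \<in> G" and T: "T (2 * e) y \<alpha> \<alpha>" for y \<alpha>
    proof -
      obtain \<beta> where \<beta>: "apply_bcontfun y \<beta> = 1" using y by (auto simp: G_def)
      have "apply_bcontfun y \<alpha> \<le> 1 + 2 * e" "apply_bcontfun y \<beta> \<le> 1 + 2 * e"
        using T \<beta> e by (auto simp: T_def)
      then obtain k :: int where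
        "\<forall>w\<in>closed_segment \<alpha> (\<beta> + of_int k * \<omega>). apply_bcontfun y w \<le> c0 * (1 + 2 * e)"
        using y unfolding G_def by blast
      moreover have "apply_bcontfun y (\<beta> + of_int k * \<omega>) = 1" using y \<beta> unfolding G_def by simp
      ultimately show ?thesis unfolding T_def by force
    qed
    show "\<exists>\<theta> \<alpha>. T 0 y \<theta> \<alpha>" if y: "y \<in> G" for y
    proof -
      obtain \<beta> where \<beta>: "apply_bcontfun y \<beta> = 1" using y by (auto simp: G_def)
      have "1 * 1 \<le> c0 * (1 + 2 * e)" using c0 e by (intro mult_mono) auto
      then have "T 0 y \<beta> \<beta>" using \<beta> by (simp add: T_def)
      then show ?thesis by blast
    qed
    show "continuous_on Pos N"
      unfolding N_def Pos_def by (intro continuous_intros continuous_on_min_value) auto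
    show "N z \<in> G" if z: "z \<in> Pos" "z \<in> joined_costs \<omega> c0" for z
    proof -
      have m: "0 < min_value z" using z by (simp add: Pos_def)
      note J = joined_costsD[OF z(2)]
      obtain \<beta> where "apply_bcontfun z \<beta> = min_value z"
        using min_value_attained[OF \<omega>, of z] J(2)[of _ 1] by auto
      then have "apply_bcontfun (N z) \<beta> = 1" using m by (simp add: N_apply)
      moreover have "\<exists>k::int. \<forall>w\<in>closed_segment \<alpha> (\<beta> + of_int k * \<omega>). apply_bcontfun (N z) w \<le> c0 * K"
        if "apply_bcontfun (N z) \<alpha> \<le> K" "apply_bcontfun (N z) \<beta> \<le> K" for K \<alpha> \<beta>
        using J(3)[of \<alpha> "K * min_value z" \<beta>] that m by (simp add: N_apply field_simps)
      ultimately show ?thesis unfolding G_def using J(2) by (auto simp: N_apply)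
    qed
  qed
  \<comment> \<open>Where the minimal cost vanishes, the optimal angle is unique modulo \<open>\<omega>\<close>; elsewhere the bound
    on the ratio squeezes the angle towards it, so that the output is continuous on the circle.\<close>
  define H where "H u t = (if u t \<in> Pos then out u t else (SOME \<theta>. apply_bcontfun (u t) \<theta> = 0))" for u t
  define \<kappa> where "\<kappa> = 2 * pi / \<omega>"
  have \<kappa>: "\<kappa> * \<omega> = 2 * pi" using \<omega> by (simp add: \<kappa>_def)
  have cis_period: "cis (\<kappa> * (\<theta> + of_int k * \<omega>)) = cis (\<kappa> * \<theta>)" for \<theta> and k :: int
  proof -
    have "\<kappa> * (\<theta> + of_int k * \<omega>) = \<kappa> * \<theta> + 2 * pi * of_int k"
      using \<kappa> by (simp add: algebra_simps)
    then show ?thesis by (simp only: cis_eq_iff) blast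
  qed
  have min0: "min_value (u t) = 0" if "admissible u" "u t \<notin> Pos" for u t
  proof -
    have "u t \<in> joined_costs \<omega> c0" using that by (auto simp: admissible_def)
    then have "0 \<le> min_value (u t)"
      unfolding min_value_def by (intro cINF_greatest) (auto simp: joined_costsD)
    then show ?thesis using that by (simp add: Pos_def)
  qed
  have H_bound: "apply_bcontfun (u t) (H u t) \<le> c * min_value (u t)" if u: "admissible u" for u t
  proof (cases "u t \<in> Pos")
    case True
    then obtain \<alpha> where "T (2 * e) (N (u t)) (out u t) \<alpha>"
      using out_props(2)[OF u, of t t t] by auto
    then have "apply_bcontfun (N (u t)) (out u t) \<le> c" unfolding T_def e(2) by auto
    then show ?thesis using True by (simp add: N_apply H_def Pos_def field_simps)
  next
    case False
    have "u t \<in> joined_costs \<omega> c0" using u by (auto simp: admissible_def)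
    then have "\<exists>\<theta>. apply_bcontfun (u t) \<theta> = 0"
      using min_value_attained[OF \<omega>, of "u t"] min0[OF u False] joined_costsD(2)[of "u t" \<omega> c0 _ 1] by auto
    from someI_ex[OF this] have "apply_bcontfun (u t) (H u t) = 0"
      using False by (simp add: H_def)
    then show ?thesis using min0[OF u False] by simp
  qed
  have H_cont: "continuous_on UNIV (\<lambda>t. cis (\<kappa> * H u t))" if u: "admissible u" for u
  proof -
    have cu: "continuous_on UNIV u" using u by (simp add: admissible_def)
    have cm: "continuous_on UNIV (\<lambda>t. min_value (u t))"
      using continuous_on_compose2[OF continuous_on_min_value cu] by auto
    have "isCont (\<lambda>t. cis (\<kappa> * H u t)) t0" for t0
    proof (cases "u t0 \<in> Pos")
      case True
      have "open (u -` Pos)"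
        unfolding Pos_def vimage_def using open_Collect_less[OF continuous_on_const cm] by simp
      then obtain d where d: "0 < d" "cball t0 d \<subseteq> u -` Pos"
        using True by (metis open_contains_cball vimageI2)
      then have sub: "{t0 - d..t0 + d} \<subseteq> u -` Pos" by (simp add: cball_eq_atLeastAtMost)
      have "continuous_on {t0 - d..t0 + d} (out u)" using out_props(1)[OF u _ sub] d by simp
      then have "continuous_on {t0 - d<..<t0 + d} (\<lambda>t. cis (\<kappa> * out u t))"
        by (intro continuous_intros) (auto intro: continuous_on_subset)
      then have "continuous_on {t0 - d<..<t0 + d} (\<lambda>t. cis (\<kappa> * H u t))"
        by (rule continuous_on_eq) (use sub in \<open>auto simp: H_def subset_iff\<close>)
      then show ?thesis using d by (simp add: continuous_on_eq_continuous_at)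
    next
      case False
      define z where "z = H u t0"
      have J0: "u t0 \<in> joined_costs \<omega> c0" using u by (auto simp: admissible_def)
      note J = joined_costsD[OF J0]
      have z: "apply_bcontfun (u t0) z = 0"
        using H_bound[OF u, of t0] min0[OF u False] J(1)[of z] by (simp add: z_def)
      have "\<exists>d>0. \<forall>t. dist t t0 < d \<longrightarrow> dist (cis (\<kappa> * H u t)) (cis (\<kappa> * z)) < r" if r: "0 < r" for r
      proof -
        \<comment> \<open>\<open>K\<close> holds the angles of one period that stay \<open>r\<close>
          away from the optimum on the circle. By uniqueness of the zero and compactness the cost at
          \<open>t0\<close> is at least some \<open>\<delta> > 0\<close> on \<open>K\<close>. Near
          \<open>t0\<close> the output costs less than \<open>\<delta>\<close> when measured at
          \<open>t0\<close>, so it avoids \<open>K\<close>.\<close>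
        define K where "K = {\<theta> \<in> {0..\<omega>}. r \<le> dist (cis (\<kappa> * \<theta>)) (cis (\<kappa> * z))}"
        have "continuous_on {0..\<omega>} (\<lambda>\<theta>. dist (cis (\<kappa> * \<theta>)) (cis (\<kappa> * z)))"
          by (intro continuous_intros)
        from continuous_on_closed_Collect_le[OF continuous_on_const this]
        have "closed K" unfolding K_def by simp
        moreover have "bounded K" by (rule bounded_subset[of "{0..\<omega>}"]) (auto simp: K_def)
        ultimately have K: "compact K" by (simp add: compact_eq_bounded_closed)
        have pos: "0 < apply_bcontfun (u t0) \<theta>" if "\<theta> \<in> K" for \<theta>
        proof (rule ccontr)
          assume "\<not> ?thesis"
          then have "apply_bcontfun (u t0) \<theta> = 0" using J(1)[of \<theta>] by simp
          then obtain k :: int where "\<theta> = z + of_int k * \<omega>" using J(4) z by blast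
          then have "cis (\<kappa> * \<theta>) = cis (\<kappa> * z)" using cis_period by simp
          then show False using that r by (simp add: K_def)
        qed
        obtain \<delta> where \<delta>: "0 < \<delta>" "\<And>\<theta>. \<theta> \<in> K \<Longrightarrow> \<delta> \<le> apply_bcontfun (u t0) \<theta>"
        proof (cases "K = {}")
          case False
          then obtain x where "x \<in> K" "\<And>y. y \<in> K \<Longrightarrow> apply_bcontfun (u t0) x \<le> apply_bcontfun (u t0) y"
            using continuous_attains_inf[OF K False, of "apply_bcontfun (u t0)"] by auto
          then show ?thesis using pos that by blast
        qed (use that[of 1] in auto)
        have "isCont u t0" using cu by (simp add: continuous_on_eq_continuous_at)
        moreover have "isCont (\<lambda>t. min_value (u t)) t0"
          using cm by (simp add: continuous_on_eq_continuous_at)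
        ultimately have "isCont (\<lambda>t. dist (u t) (u t0) + c * min_value (u t)) t0"
          by (intro continuous_intros)
        then obtain d where d: "0 < d" "\<And>t. dist t t0 < d \<Longrightarrow>
            dist (dist (u t) (u t0) + c * min_value (u t)) (dist (u t0) (u t0) + c * min_value (u t0)) < \<delta>"
          unfolding continuous_at_eps_delta using \<delta>(1) by (metis dist_commute)
        have "dist (cis (\<kappa> * H u t)) (cis (\<kappa> * z)) < r" if t: "dist t t0 < d" for t
        proof -
          have "dist (u t) (u t0) + c * min_value (u t) < \<delta>"
            using d(2)[OF t] min0[OF u False] by (simp add: dist_real_def)
          then have lt: "apply_bcontfun (u t0) (H u t) < \<delta>"
            using H_bound[OF u, of t] abs_bcontfun_diff_le[of "u t" "H u t" "u t0"] by linarith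
          obtain k :: int where k: "H u t + of_int k * \<omega> \<in> {0..\<omega>}"
            using reduce_mod_period[OF \<omega>] by blast
          then have "H u t + of_int k * \<omega> \<notin> K" using \<delta>(2) lt J(2) by (metis not_le)
          then show ?thesis using k cis_period by (simp add: K_def)
        qed
        then show ?thesis using d(1) by blast
      qed
      then show ?thesis unfolding continuous_at_eps_delta z_def by (metis dist_commute)
    qed
    then show ?thesis by (simp add: continuous_on_eq_continuous_at)
  qed
  \<comment> \<open>Only the output modulo the period is continuous so far. Lifting it changes
    \<open>H\<close> by multiples of \<open>\<omega>\<close>, which leaves the cost
    unchanged.\<close>
  define F where "F u t = circle_lift (\<lambda>t. cis (\<kappa> * H u t)) t / \<kappa>" for u t
  have "\<kappa> > 0" using \<omega> by (simp add: \<kappa>_def)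
  have F1: "continuous_on UNIV (F u)" if "admissible u" for u
    unfolding F_def using circle_lift(1)[OF H_cont[OF that]] \<open>\<kappa> > 0\<close>
    by (intro continuous_intros) auto
  have F2: "apply_bcontfun (u t) (F u t) \<le> c * min_value (u t)" if u: "admissible u" for u t
  proof -
    have "cis (\<kappa> * F u t) = cis (\<kappa> * H u t)"
      using circle_lift(2)[OF H_cont[OF u]] \<open>\<kappa> > 0\<close> by (simp add: F_def)
    then obtain k :: int where "\<kappa> * F u t = \<kappa> * H u t + 2 * pi * of_int k"
      unfolding cis_eq_iff by blast
    also have "\<dots> = \<kappa> * (H u t + of_int k * \<omega>)" using \<kappa> by (simp add: algebra_simps)
    finally have "F u t = H u t + of_int k * \<omega>" using \<open>\<kappa> > 0\<close> by simp
    moreover have "u t \<in> joined_costs \<omega> c0" using u by (auto simp: admissible_def)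
    ultimately show ?thesis using H_bound[OF u] joined_costsD(2)[of "u t"] by simp
  qed
  have F3: "F u t = F u' t"
    if u: "admissible u" and u': "admissible u'" and "0 \<le> t" and eq: "\<forall>r\<le>t. u r = u' r" for u u' t
  proof -
    have "H u r = H u' r" if "r \<in> {0..t}" for r
      using that eq out_cong[of r u u', OF _ u] by (auto simp: H_def)
    then show ?thesis
      unfolding F_def using circle_lift_cong[OF H_cont[OF u] _ H_cont[OF u'] _ \<open>0 \<le> t\<close>] by simp
  qed
  have "causal_selector \<omega> c0 c F"
    unfolding causal_selector_def
    by (intro allI impI conjI; elim conjE) (simp_all add: F1 F2 admissible_def, rule F3, simp_all add: admissible_def)
  then show ?thesis by blast
qed

section \<open>Orientations and the upper bound principle\<close>

definition unit_vec :: "real \<Rightarrow> plane" where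
  "unit_vec \<theta> = vector [cos \<theta>, sin \<theta>]"

lemma unit_vec_nth [simp]: "unit_vec \<theta> $ 1 = cos \<theta>" "unit_vec \<theta> $ 2 = sin \<theta>"
  by (simp_all add: unit_vec_def)

lemma plane_eq_iff: "(v :: plane) = w \<longleftrightarrow> v $ 1 = w $ 1 \<and> v $ 2 = w $ 2"
  by (simp add: vec_eq_iff forall_2)

lemma inner_plane: "(v :: plane) \<bullet> w = v $ 1 * w $ 1 + v $ 2 * w $ 2"
  by (simp add: inner_vec_def sum_2)

lemma norm_plane: "norm (v :: plane) = sqrt ((v $ 1)\<^sup>2 + (v $ 2)\<^sup>2)"
  by (simp add: norm_eq_sqrt_inner inner_plane power2_eq_square)

lemma norm_unit_vec [simp]: "norm (unit_vec \<theta>) = 1"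
  by (simp add: norm_plane)

lemma unit_vec_add_pi: "unit_vec (\<theta> + pi) = - unit_vec \<theta>"
  by (simp add: plane_eq_iff)

lemma rot90_unit_vec: "rot90 (unit_vec \<theta>) = unit_vec (\<theta> + pi / 2)"
  by (simp add: plane_eq_iff rot90_def cos_add sin_add)

lemma unit_vec_exists:
  assumes "norm v = 1"
  obtains \<theta> where "v = unit_vec \<theta>"
proof -
  have "(v $ 1)\<^sup>2 + (v $ 2)\<^sup>2 = 1" using assms by (simp add: norm_plane)
  then obtain \<theta> where "v $ 1 = cos \<theta>" "v $ 2 = sin \<theta>"
    using sincos_total_2pi by metis
  then show ?thesis using that[of \<theta>] by (simp add: plane_eq_iff)
qed

lemma continuous_on_vector_2 [continuous_intros]:
  fixes f g :: "'a::t2_space \<Rightarrow> real"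
  assumes "continuous_on S f" "continuous_on S g"
  shows "continuous_on S (\<lambda>x. vector [f x, g x] :: plane)"
proof -
  have "continuous_on S (\<lambda>x. (\<chi> i. if i = 1 then f x else g x) :: plane)"
  proof (rule continuous_on_vec_lambda)
    show "continuous_on S (\<lambda>x. if i = 1 then f x else g x)" for i :: 2
      by (cases "i = 1") (simp_all add: assms)
  qed
  then show ?thesis
    by (rule continuous_on_eq) (simp add: plane_eq_iff)
qed

lemma continuous_on_unit_vec [continuous_intros]:
  fixes f :: "'a::t2_space \<Rightarrow> real"
  shows "continuous_on S f \<Longrightarrow> continuous_on S (\<lambda>x. unit_vec (f x))"
  unfolding unit_vec_def by (intro continuous_intros)

definition dir :: "real \<Rightarrow> orientation" where
  "dir \<theta> = orientation_of (unit_vec \<theta>)"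

lemma orientation_of_eq:
  "norm u = 1 \<Longrightarrow> norm v = 1 \<Longrightarrow> u = v \<or> u = - v \<Longrightarrow> orientation_of u = orientation_of v"
  by (rule Quotient_rel_abs[OF Quotient_orientation]) simp

lemma orientation_cases:
  obtains v where "norm v = 1" "\<alpha> = orientation_of v"
proof
  show "norm (rep_orientation \<alpha>) = 1"
    using Quotient_rep_reflp[OF Quotient_orientation, of \<alpha>] by simp
  show "\<alpha> = orientation_of (rep_orientation \<alpha>)"
    by (rule Quotient_abs_rep[OF Quotient_orientation, symmetric])
qed

lemma dir_cases: obtains \<theta> where "\<alpha> = dir \<theta>"
  by (metis orientation_cases unit_vec_exists dir_def)

lemma range_dir: "range dir = UNIV"
  using dir_cases by (metis UNIV_eq_I rangeI)

lemma dir_add_pi: "dir (\<theta> + pi) = dir \<theta>"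
  unfolding dir_def by (rule orientation_of_eq) (simp_all add: unit_vec_add_pi)

lemma perp_dir: "perp (dir \<theta>) = dir (\<theta> + pi / 2)"
  unfolding dir_def by (subst perp.abs_eq) (simp_all add: rot90_unit_vec eq_onp_def)

lemma continuous_on_orientation_of: "continuous_on (sphere 0 1) orientation_of"
  unfolding continuous_on_open_invariant
proof (intro allI impI)
  fix U :: "orientation set" assume "open U"
  then have "openin (top_of_set (sphere 0 1)) {v \<in> sphere 0 1. orientation_of v \<in> U}"
    by (simp add: open_orientation_def)
  then obtain A where "open A" "{v \<in> sphere 0 1. orientation_of v \<in> U} = sphere 0 1 \<inter> A"
    by (auto simp: openin_open)
  moreover from this have "A \<inter> sphere 0 1 = orientation_of -` U \<inter> sphere 0 1"
    by blast
  ultimately show "\<exists>A. open A \<and> A \<inter> sphere 0 1 = orientation_of -` U \<inter> sphere 0 1"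
    by blast
qed

lemma continuous_on_dir: "continuous_on S (f :: 'a::t2_space \<Rightarrow> real) \<Longrightarrow> continuous_on S (\<lambda>x. dir (f x))"
  unfolding dir_def
  by (rule continuous_on_compose2[OF continuous_on_orientation_of]) (auto intro!: continuous_intros)

text \<open>One compact period decides everything. On a compact time window times that period joint
  continuity is uniform, which turns it into continuity for the sup norm.\<close>

lemma periodic_family_bcontfun:
  fixes g :: "real \<Rightarrow> real \<Rightarrow> real"
  assumes \<omega>: "0 < \<omega>" and per: "\<And>t \<theta>. g t (\<theta> + \<omega>) = g t \<theta>"
    and cont: "continuous_on UNIV (\<lambda>(t, \<theta>). g t \<theta>)"
  shows "g t \<in> bcontfun" "continuous_on UNIV (\<lambda>t. Bcontfun (g t))"
proof -
  have red: "\<exists>\<theta>'\<in>{0..\<omega>}. \<forall>t. g t \<theta> = g t \<theta>'" for \<theta>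
  proof -
    obtain k :: int where "\<theta> + of_int k * \<omega> \<in> {0..\<omega>}"
      using reduce_mod_period[OF \<omega>] by blast
    moreover have "g t \<theta> = g t (\<theta> + of_int k * \<omega>)" for t
      using periodic_int[of "g t" \<omega>] per by simp
    ultimately show ?thesis by blast
  qed
  show bc: "g t \<in> bcontfun" for t
  proof -
    have cg: "continuous_on UNIV (g t)"
      using continuous_on_compose2[OF cont, OF continuous_on_Pair[OF continuous_on_const continuous_on_id], of t] by simp
    have "compact (g t ` {0..\<omega>})"
      by (intro compact_continuous_image continuous_on_subset[OF cg]) auto
    then obtain b where "\<And>y. y \<in> g t ` {0..\<omega>} \<Longrightarrow> norm y \<le> b"
      using compact_imp_bounded bounded_iff by metis
    then have "norm (g t \<theta>) \<le> b" for \<theta>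
      using red[of \<theta>] by (metis imageI)
    then show ?thesis by (rule bcontfun_normI[OF cg])
  qed
  have "\<exists>d>0. \<forall>t. dist t t0 < d \<longrightarrow> dist (Bcontfun (g t)) (Bcontfun (g t0)) < r" if r: "0 < r" for t0 r
  proof -
    have "uniformly_continuous_on ({t0 - 1..t0 + 1} \<times> {0..\<omega>}) (\<lambda>(t, \<theta>). g t \<theta>)"
      by (intro compact_uniformly_continuous continuous_on_subset[OF cont] compact_Times) auto
    then obtain d where d: "0 < d" "\<And>x y. x \<in> {t0 - 1..t0 + 1} \<times> {0..\<omega>} \<Longrightarrow> y \<in> {t0 - 1..t0 + 1} \<times> {0..\<omega>} \<Longrightarrow>
        dist y x < d \<Longrightarrow> dist (case y of (t, \<theta>) \<Rightarrow> g t \<theta>) (case x of (t, \<theta>) \<Rightarrow> g t \<theta>) < r / 2"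
      unfolding uniformly_continuous_on_def using r by (metis half_gt_zero)
    have "dist (Bcontfun (g t)) (Bcontfun (g t0)) < r" if t: "dist t t0 < min d 1" for t
    proof -
      have "dist (g t \<theta>) (g t0 \<theta>) \<le> r / 2" for \<theta>
      proof -
        obtain \<theta>' where \<theta>': "\<theta>' \<in> {0..\<omega>}" "\<forall>t. g t \<theta> = g t \<theta>'" using red by blast
        moreover have "t \<in> {t0 - 1..t0 + 1}" using t by (auto simp: dist_real_def)
        ultimately have "dist (g t \<theta>') (g t0 \<theta>') < r / 2"
          using d(2)[of "(t0, \<theta>')" "(t, \<theta>')"] t by (auto simp: dist_Pair_Pair dist_real_def)
        then show ?thesis using \<theta>' by simp
      qed
      then have "dist (Bcontfun (g t)) (Bcontfun (g t0)) \<le> r / 2"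
        by (intro dist_bound) (simp add: Bcontfun_inverse bc)
      then show ?thesis using r by simp
    qed
    then show ?thesis using d(1) by (intro exI[of _ "min d 1"]) auto
  qed
  then show "continuous_on UNIV (\<lambda>t. Bcontfun (g t))"
    unfolding continuous_on_iff by (metis UNIV_I)
qed

section \<open>From cost estimates to bounds on the stability ratio\<close>

definition distinct_points :: "nat \<Rightarrow> (nat \<Rightarrow> plane) \<Rightarrow> bool" where
  "distinct_points n P \<longleftrightarrow> (\<exists>i<n. \<exists>j<n. P i \<noteq> P j)"

lemma cost_ratio_le:
  assumes nonneg: "\<And>\<alpha>. 0 \<le> f \<alpha> n P" and "1 \<le> c" and le: "f \<alpha> n P \<le> c * (INF \<gamma>. f \<gamma> n P)"
  shows "cost_ratio f \<alpha> n P \<le> ereal c"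
proof (cases "(INF \<gamma>. f \<gamma> n P) = 0")
  case True
  then have "f \<alpha> n P = 0" using le nonneg[of \<alpha>] by simp
  then show ?thesis using True \<open>1 \<le> c\<close> by (simp add: cost_ratio_def one_ereal_def)
next
  case False
  have "0 \<le> (INF \<gamma>. f \<gamma> n P)" using nonneg by (intro cINF_greatest) auto
  then show ?thesis using False le by (simp add: cost_ratio_def Let_def field_simps)
qed

text \<open>Any competitor \<open>\<gamma>\<close> bounds the minimum from above. If the minimum is
  0, the positive cost of \<open>\<alpha>\<close> makes the ratio infinite.\<close>

lemma cost_ratio_ge:
  assumes nonneg: "\<And>\<alpha>. 0 \<le> f \<alpha> n P" and "0 < c" "0 < f \<alpha> n P" and le: "c * f \<gamma> n P \<le> f \<alpha> n P"
  shows "ereal c \<le> cost_ratio f \<alpha> n P"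
proof -
  have "bdd_below (range (\<lambda>\<gamma>. f \<gamma> n P))" using nonneg by (intro bdd_belowI2[of _ 0]) simp
  then have "(INF \<gamma>. f \<gamma> n P) \<le> f \<gamma> n P" by (rule cINF_lower) simp
  then have "c * (INF \<gamma>. f \<gamma> n P) \<le> f \<alpha> n P" using \<open>0 < c\<close> le by (meson less_imp_le mult_left_mono order_trans)
  moreover have "0 \<le> (INF \<gamma>. f \<gamma> n P)" using nonneg by (intro cINF_greatest) auto
  ultimately show ?thesis using assms(3) by (simp add: cost_ratio_def Let_def field_simps)
qed

text \<open>For each \<open>\<epsilon>\<close> the selector for \<open>c0 + \<epsilon>\<close> is
  applied to the path of cost functions, with the input extended to all real times by
  constants.\<close>

lemma rho_TS_le:
  fixes f :: "orientation \<Rightarrow> nat \<Rightarrow> (nat \<Rightarrow> plane) \<Rightarrow> real"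
  assumes \<omega>: "0 < \<omega>" and c0: "1 \<le> c0"
    and per: "\<And>\<theta> n P. f (dir (\<theta> + \<omega>)) n P = f (dir \<theta>) n P"
    and nonneg: "\<And>\<alpha> n P. distinct_points n P \<Longrightarrow> 0 \<le> f \<alpha> n P"
    and cong: "\<And>\<alpha> n P Q. (\<And>i. i < n \<Longrightarrow> P i = Q i) \<Longrightarrow> f \<alpha> n P = f \<alpha> n Q"
    and cont: "\<And>n p. 0 < n \<Longrightarrow> (\<And>i. i < n \<Longrightarrow> continuous_on UNIV (p i)) \<Longrightarrow>
      continuous_on UNIV (\<lambda>(t::real, \<theta>). f (dir \<theta>) n (\<lambda>i. p i t))"
    and joined: "\<And>n P K \<alpha> \<beta>. distinct_points n P \<Longrightarrow> f (dir \<alpha>) n P \<le> K \<Longrightarrow> f (dir \<beta>) n P \<le> K \<Longrightarrow>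
      \<exists>k::int. \<forall>w\<in>closed_segment \<alpha> (\<beta> + of_int k * \<omega>). f (dir w) n P \<le> c0 * K"
    and zeros: "\<And>n P \<alpha> \<beta>. distinct_points n P \<Longrightarrow> f (dir \<alpha>) n P = 0 \<Longrightarrow> f (dir \<beta>) n P = 0 \<Longrightarrow>
      \<exists>k::int. \<beta> = \<alpha> + of_int k * \<omega>"
  shows "rho_TS f \<le> ereal c0"
proof (rule ereal_le_epsilon2)
  fix \<epsilon> :: real assume "0 < \<epsilon>"
  define c where "c = c0 + \<epsilon>"
  have c: "c0 < c" using \<open>0 < \<epsilon>\<close> by (simp add: c_def)
  obtain G where "causal_selector \<omega> c0 c G"
    using causal_selection[OF \<omega> c0 c] by blast
  note G = causal_selectorD[OF this]
  \<comment> \<open>Freezing the input at the current time makes the algorithm causal by construction.\<close>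
  define clamp where "clamp h r = max 0 (min r h)" for h r :: real
  define cost where "cost n p h r \<theta> = f (dir \<theta>) n (\<lambda>i. p i (clamp h r))" for n p h r \<theta>
  define path where "path n p h r = Bcontfun (cost n p h r)" for n p h r
  define A where "A n p t = dir (G (path n p t) t)" for n p t
  have path: "continuous_on UNIV (path n p h)" "range (path n p h) \<subseteq> joined_costs \<omega> c0"
    "apply_bcontfun (path n p h r) = cost n p h r"
    if m: "moving_point_set n T p" and h: "h \<in> {0..T}" for n T p h r
  proof -
    have "0 < n" using m unfolding moving_point_set_def by fastforce
    have clamp: "clamp h r \<in> {0..T}" for r using h by (auto simp: clamp_def)
    have "continuous_on UNIV (\<lambda>r. p i (clamp h r))" if "i < n" for i
    proof (rule continuous_on_compose2[of "{0..T}" "p i" UNIV "clamp h"])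
      show "continuous_on {0..T} (p i)" using m that by (simp add: moving_point_set_def)
      show "continuous_on UNIV (clamp h)" unfolding clamp_def by (intro continuous_intros)
    qed (use clamp in auto)
    then have cont': "continuous_on UNIV (\<lambda>(r, \<theta>). cost n p h r \<theta>)"
      unfolding cost_def using cont[OF \<open>0 < n\<close>, of "\<lambda>i r. p i (clamp h r)"] by simp
    have per': "cost n p h r (\<theta> + \<omega>) = cost n p h r \<theta>" for r \<theta>
      by (simp add: cost_def per)
    note bc = periodic_family_bcontfun[of \<omega> "cost n p h", OF \<omega> per' cont']
    show "continuous_on UNIV (path n p h)" using bc(2) by (simp add: path_def)
    have ap: "apply_bcontfun (path n p h r) \<theta> = f (dir \<theta>) n (\<lambda>i. p i (clamp h r))" for r \<theta>
      using bc(1) by (simp add: path_def Bcontfun_inverse cost_def)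
    then show "apply_bcontfun (path n p h r) = cost n p h r"
      by (simp add: fun_eq_iff cost_def)
    have dp: "distinct_points n (\<lambda>i. p i (clamp h r))" for r
      using m clamp[of r] by (auto simp: distinct_points_def moving_point_set_def)
    have "path n p h r \<in> joined_costs \<omega> c0" for r
      unfolding joined_costs_def using joined[OF dp[of r]] nonneg[OF dp[of r]] zeros[OF dp[of r]]
      by (simp add: per ap)
    then show "range (path n p h) \<subseteq> joined_costs \<omega> c0" by auto
  qed
  have state: "state_aware A"
    unfolding state_aware_def
  proof (intro allI impI)
    fix n T p T' q t
    assume "moving_point_set n T p" "moving_point_set n T' q" and t: "0 \<le> t \<and> t \<le> T \<and> t \<le> T'"
      and eq: "\<forall>i<n. \<forall>s\<in>{0..t}. p i s = q i s"
    have "cost n p t r = cost n q t r" for r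
      unfolding cost_def using eq t by (intro ext cong) (auto simp: clamp_def)
    then have "path n p t = path n q t" by (intro ext) (simp add: path_def)
    then show "A n p t = A n q t" by (simp add: A_def)
  qed
  \<comment> \<open>The input frozen at \<open>t\<close> agrees up to \<open>t\<close> with the
    input frozen at the horizon. Causality of the selector therefore glues the separately defined
    outputs into one continuous curve.\<close>
  have A: "A n p t = dir (G (path n p T) t)" if m: "moving_point_set n T p" and t: "t \<in> {0..T}" for n T p t
  proof -
    have "T \<in> {0..T}" using m by (auto simp: moving_point_set_def)
    have "path n p t r = path n p T r" if "r \<le> t" for r
      using that t by (simp add: path_def cost_def[abs_def] clamp_def min_def)
    then show ?thesis
      using G(3)[OF path(1,2)[OF m t] path(1,2)[OF m \<open>T \<in> {0..T}\<close>], of t] t by (simp add: A_def)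
  qed
  have continuous: "continuous_output A"
    unfolding continuous_output_def
  proof (intro allI impI)
    fix n T p assume m: "moving_point_set n T p"
    then have "T \<in> {0..T}" by (auto simp: moving_point_set_def)
    then have "continuous_on {0..T} (\<lambda>t. dir (G (path n p T) t))"
      by (intro continuous_on_dir continuous_on_subset[OF G(1)[OF path(1,2)[OF m]]]) auto
    then show "continuous_on {0..T} (A n p)"
      by (rule continuous_on_eq) (use A[OF m] in simp)
  qed
  have ratio: "cost_ratio f (A n p t) n (\<lambda>i. p i t) \<le> ereal c"
    if m: "moving_point_set n T p" and t: "t \<in> {0..T}" for n T p t
  proof -
    have cl: "clamp t t = t" using t by (simp add: clamp_def)
    have "distinct_points n (\<lambda>i. p i t)"
      using m t by (auto simp: distinct_points_def moving_point_set_def)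
    moreover have "min_value (path n p t t) = (INF \<theta>. f (dir \<theta>) n (\<lambda>i. p i t))"
      unfolding min_value_def path(3)[OF m t] cost_def cl ..
    moreover have "\<dots> = (INF \<gamma>. f \<gamma> n (\<lambda>i. p i t))"
      using image_image[of "\<lambda>\<gamma>. f \<gamma> n (\<lambda>i. p i t)" dir UNIV] by (simp add: range_dir)
    ultimately show ?thesis
      using G(2)[OF path(1,2)[OF m t], of t] path(3)[OF m t, of t] c c0 nonneg
      by (intro cost_ratio_le) (auto simp: A_def cost_def cl)
  qed
  have "rho_TS f \<le> (SUP (n, T, p)\<in>{(n, T, p). moving_point_set n T p}.
      SUP t\<in>{0..T}. cost_ratio f (A n p t) n (\<lambda>i. p i t))"
    unfolding rho_TS_def by (rule INF_lower) (simp add: state continuous)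
  also have "\<dots> \<le> ereal c"
    using ratio by (auto intro!: SUP_least)
  finally show "rho_TS f \<le> ereal c0 + ereal \<epsilon>" by (simp add: c_def)
qed

text \<open>Against one fixed motion an algorithm is merely a continuous curve of
  orientations.\<close>

lemma rho_TS_ge:
  assumes m: "moving_point_set n T p"
    and "\<And>a. continuous_on {0..T} a \<Longrightarrow> \<exists>t\<in>{0..T}. ereal c \<le> cost_ratio f (a t) n (\<lambda>i. p i t)"
  shows "ereal c \<le> rho_TS f"
  unfolding rho_TS_def
proof (rule INF_greatest)
  fix A assume "A \<in> {A. state_aware A \<and> continuous_output A}"
  then have "continuous_on {0..T} (A n p)" using m by (simp add: continuous_output_def)
  then obtain t where "t \<in> {0..T}" "ereal c \<le> cost_ratio f (A n p t) n (\<lambda>i. p i t)"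
    using assms(2) by blast
  then have "ereal c \<le> (SUP t\<in>{0..T}. cost_ratio f (A n p t) n (\<lambda>i. p i t))"
    by (rule SUP_upper2)
  then show "ereal c \<le> (SUP (n, T, p)\<in>{(n, T, p). moving_point_set n T p}.
      SUP t\<in>{0..T}. cost_ratio f (A n p t) n (\<lambda>i. p i t))"
    by (intro SUP_upper2[of "(n, T, p)"]) (use m in auto)
qed

section \<open>Extents and the covering strip\<close>

text \<open>Defined for all vectors and not only unit ones, so that sublinearity can be stated and
  unit vectors can be decomposed.\<close>

definition width :: "nat \<Rightarrow> (nat \<Rightarrow> plane) \<Rightarrow> plane \<Rightarrow> real" where
  "width n P x = Max ((\<lambda>(i, j). (P i - P j) \<bullet> x) ` ({..<n} \<times> {..<n}))"

lemma extent_orientation_of: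
  assumes "norm v = 1"
  shows "extent (orientation_of v) n P = width n P v"
proof -
  have "{(P i - P j) \<bullet> v | i j. i < n \<and> j < n} = (\<lambda>(i, j). (P i - P j) \<bullet> v) ` ({..<n} \<times> {..<n})"
    by auto
  then show ?thesis using assms by (simp add: extent.abs_eq eq_onp_def width_def)
qed

lemma perp_orientation_of:
  assumes "norm v = 1"
  shows "perp (orientation_of v) = orientation_of (rot90 v)"
  using assms by (simp add: perp.abs_eq eq_onp_def)

lemma extent_dir: "extent (dir \<theta>) n P = width n P (unit_vec \<theta>)"
  by (simp add: dir_def extent_orientation_of)

lemma width_ge: "i < n \<Longrightarrow> j < n \<Longrightarrow> (P i - P j) \<bullet> x \<le> width n P x"
  unfolding width_def by (rule Max_ge) force+

lemma width_le:
  assumes "0 < n" "\<And>i j. i < n \<Longrightarrow> j < n \<Longrightarrow> (P i - P j) \<bullet> x \<le> b"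
  shows "width n P x \<le> b"
  unfolding width_def using assms by (subst Max_le_iff) auto

lemma width_nonneg: "0 < n \<Longrightarrow> 0 \<le> width n P x"
  using width_ge[of 0 n 0 P x] by simp

lemma width_linear_combination:
  assumes "0 < n" "0 \<le> a" "0 \<le> b"
  shows "width n P (a *\<^sub>R x + b *\<^sub>R y) \<le> a * width n P x + b * width n P y"
proof (rule width_le[OF assms(1)])
  fix i j assume "i < n" "j < n"
  then show "(P i - P j) \<bullet> (a *\<^sub>R x + b *\<^sub>R y) \<le> a * width n P x + b * width n P y"
    using assms width_ge[of i n j P x] width_ge[of i n j P y]
    by (simp add: inner_add_right add_mono mult_left_mono)
qed

lemma width_minus: "width n P (- x) = width n P x"
proof -
  have "(\<lambda>(i, j). (P i - P j) \<bullet> (- x)) ` ({..<n} \<times> {..<n}) = (\<lambda>(i, j). (P i - P j) \<bullet> x) ` ({..<n} \<times> {..<n})"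
  proof -
    have "(\<lambda>(i, j). (P i - P j) \<bullet> (- x)) = (\<lambda>(i, j). (P i - P j) \<bullet> x) \<circ> prod.swap"
      by (auto simp: fun_eq_iff inner_diff_left)
    then show ?thesis by (simp only: image_comp[symmetric] product_swap)
  qed
  then show ?thesis by (simp add: width_def)
qed

text \<open>Directions of zero width are orthogonal to the nonzero difference of two points; in the
  plane two such directions are parallel.\<close>

lemma width_zeros_parallel:
  assumes P: "distinct_points n P" and "width n P x = 0" "width n P y = 0"
  shows "x $ 1 * y $ 2 = x $ 2 * y $ 1"
proof -
  obtain i j where ij: "i < n" "j < n" "P i \<noteq> P j" using P by (auto simp: distinct_points_def)
  have zero: "(P i - P j) \<bullet> z = 0" if "width n P z = 0" for z
    using width_ge[of i n j P z] width_ge[of j n i P z] ij that by (simp add: inner_diff_left)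
  define d where "d = P i - P j"
  have "d \<noteq> 0" using ij by (simp add: d_def)
  then have nz: "d $ 1 \<noteq> 0 \<or> d $ 2 \<noteq> 0" by (simp add: plane_eq_iff)
  have "d $ 1 * x $ 1 + d $ 2 * x $ 2 = 0" "d $ 1 * y $ 1 + d $ 2 * y $ 2 = 0"
    using zero assms by (simp_all add: d_def inner_plane)
  then have "d $ 1 * (x $ 1 * y $ 2 - x $ 2 * y $ 1) = 0" "d $ 2 * (x $ 1 * y $ 2 - x $ 2 * y $ 1) = 0"
    by algebra+
  then show ?thesis using nz by auto
qed

lemma width_zeros_angle:
  assumes P: "distinct_points n P" and "width n P (unit_vec \<alpha>) = 0" "width n P (unit_vec \<beta>) = 0"
  shows "\<exists>k::int. \<beta> = \<alpha> + of_int k * pi"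
proof -
  have "sin (\<beta> - \<alpha>) = 0"
    using width_zeros_parallel[OF assms] by (simp add: sin_diff mult.commute)
  then obtain k :: int where "\<beta> - \<alpha> = of_int k * pi"
    by (auto simp: sin_zero_iff_int2)
  then show ?thesis by (intro exI[of _ k]) simp
qed

lemma continuous_on_Max_image:
  fixes f :: "'i \<Rightarrow> 'a::topological_space \<Rightarrow> 'b::linorder_topology"
  assumes "finite I" "I \<noteq> {}" "\<And>i. i \<in> I \<Longrightarrow> continuous_on S (f i)"
  shows "continuous_on S (\<lambda>x. Max ((\<lambda>i. f i x) ` I))"
  using assms
proof (induction rule: finite_ne_induct)
  case (insert i I)
  then have "continuous_on S (\<lambda>x. max (f i x) (Max ((\<lambda>i. f i x) ` I)))"
    by (intro continuous_on_max) auto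
  then show ?case using insert by simp
qed simp

lemma continuous_on_width:
  assumes "0 < n" "\<And>i. i < n \<Longrightarrow> continuous_on S (\<lambda>x. P x i)" "continuous_on S v"
  shows "continuous_on S (\<lambda>x. width n (P x) (v x))"
proof -
  have "continuous_on S (\<lambda>x. Max ((\<lambda>ij. (P x (fst ij) - P x (snd ij)) \<bullet> v x) ` ({..<n} \<times> {..<n})))"
    using assms by (intro continuous_on_Max_image) (auto intro!: continuous_intros)
  then show ?thesis by (simp add: width_def split_beta)
qed

lemma width_cong: "(\<And>i. i < n \<Longrightarrow> P i = Q i) \<Longrightarrow> width n P x = width n Q x"
  unfolding width_def by (intro arg_cong[where f = Max] image_cong) auto

text \<open>By the law of sines the intermediate unit vector is a combination of the outer two with
  weights \<open>sin (\<phi> - s) / sin \<phi>\<close> and \<open>sin s / sin \<phi>\<close>;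
  sublinearity does the rest.\<close>

lemma width_between:
  assumes "0 < n" "0 < \<phi>" "\<phi> < pi" "0 \<le> s" "s \<le> \<phi>"
  shows "sin \<phi> * width n P (unit_vec (\<alpha> + s)) \<le>
    sin (\<phi> - s) * width n P (unit_vec \<alpha>) + sin s * width n P (unit_vec (\<alpha> + \<phi>))"
proof -
  have pos: "0 < sin \<phi>" "0 \<le> sin (\<phi> - s)" "0 \<le> sin s"
    using assms by (auto intro: sin_gt_zero sin_ge_zero)
  have "unit_vec (\<alpha> + s) = (sin (\<phi> - s) / sin \<phi>) *\<^sub>R unit_vec \<alpha> + (sin s / sin \<phi>) *\<^sub>R unit_vec (\<alpha> + \<phi>)"
  proof -
    have "sin \<phi> * cos (\<alpha> + s) = sin (\<phi> - s) * cos \<alpha> + sin s * cos (\<alpha> + \<phi>)"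
      "sin \<phi> * sin (\<alpha> + s) = sin (\<phi> - s) * sin \<alpha> + sin s * sin (\<alpha> + \<phi>)"
      by (simp_all add: sin_diff cos_add sin_add algebra_simps)
    then show ?thesis using pos by (simp add: plane_eq_iff field_simps)
  qed
  then have "width n P (unit_vec (\<alpha> + s)) \<le> (sin (\<phi> - s) / sin \<phi>) * width n P (unit_vec \<alpha>) +
      (sin s / sin \<phi>) * width n P (unit_vec (\<alpha> + \<phi>))"
    using width_linear_combination[OF assms(1), of "sin (\<phi> - s) / sin \<phi>" "sin s / sin \<phi>" P] pos by simp
  then show ?thesis using pos by (simp add: field_simps)
qed

lemma width_unit_vec_periodic: "width n P (unit_vec (\<theta> + of_int k * pi)) = width n P (unit_vec \<theta>)"
  by (rule periodic_int) (simp add: unit_vec_add_pi width_minus)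

lemma f_STRIP_dir: "f_STRIP (dir \<theta>) n P = width n P (unit_vec (\<theta> + pi / 2))"
  by (simp add: f_STRIP_def perp_dir extent_dir)

lemma f_OBB_dir: "f_OBB (dir \<theta>) n P = width n P (unit_vec \<theta>) * width n P (unit_vec (\<theta> + pi / 2))"
  by (simp add: f_OBB_def perp_dir extent_dir)

lemma distinct_points_pos: "distinct_points n P \<Longrightarrow> 0 < n"
  by (auto simp: distinct_points_def)

text \<open>The weights from \<open>width_between\<close> add up to
  \<open>cos (\<phi> / 2 - s) / cos (\<phi> / 2)\<close>. This is at most
  \<open>1 / cos (pi / 4)\<close>, because \<open>\<phi>\<close> is at most a right angle. Equal end
  points are separate, as \<open>sin \<phi>\<close> is then 0.\<close>

lemma width_between_le_sqrt2:
  assumes "0 < n" "\<alpha> \<le> \<beta>" "\<beta> \<le> \<alpha> + pi / 2"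
    and "width n P (unit_vec \<alpha>) \<le> K" "width n P (unit_vec \<beta>) \<le> K" "w \<in> {\<alpha>..\<beta>}"
  shows "width n P (unit_vec w) \<le> sqrt 2 * K"
proof (cases "\<alpha> = \<beta>")
  case True
  have "0 \<le> K" using width_nonneg[OF assms(1)] assms(4) order_trans by blast
  then have "K \<le> sqrt 2 * K" by (simp add: mult_le_cancel_right1)
  then show ?thesis using True assms by auto
next
  case False
  have K: "0 \<le> K" using width_nonneg[OF assms(1)] assms(4) order_trans by blast
  define \<phi> where "\<phi> = \<beta> - \<alpha>"
  define s where "s = w - \<alpha>"
  have \<phi>: "0 < \<phi>" "\<phi> \<le> pi / 2" and s: "0 \<le> s" "s \<le> \<phi>"
    using False assms by (auto simp: \<phi>_def s_def)
  have "\<phi> < pi" using \<phi> pi_gt_zero by linarith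
  have eqs: "\<alpha> + s = w" "\<alpha> + \<phi> = \<beta>" by (simp_all add: s_def \<phi>_def)
  have pos: "0 \<le> sin (\<phi> - s)" "0 \<le> sin s"
    using \<phi> s \<open>\<phi> < pi\<close> by (auto intro: sin_ge_zero)
  have "sin \<phi> * width n P (unit_vec w) \<le> sin (\<phi> - s) * K + sin s * K"
    using width_between[OF assms(1) \<phi>(1) \<open>\<phi> < pi\<close> s, of P \<alpha>] pos assms(4,5) unfolding eqs
    by (smt (verit, best) mult_left_mono)
  also have "\<dots> = 2 * sin (\<phi> / 2) * cos (\<phi> / 2 - s) * K"
  proof -
    have "sin (\<phi> / 2 + (\<phi> / 2 - s)) + sin (\<phi> / 2 - (\<phi> / 2 - s)) = 2 * sin (\<phi> / 2) * cos (\<phi> / 2 - s)"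
      by (simp only: sin_add sin_diff)
    then show ?thesis by (simp flip: distrib_right)
  qed
  also have "\<dots> \<le> 2 * sin (\<phi> / 2) * 1 * K"
    using \<phi> \<open>\<phi> < pi\<close> K by (intro mult_right_mono mult_left_mono) (auto intro: sin_ge_zero)
  also have "\<dots> \<le> 2 * sin (\<phi> / 2) * (sqrt 2 * cos (\<phi> / 2)) * K"
  proof -
    have "cos (pi / 4) \<le> cos (\<phi> / 2)" using \<phi> by (intro cos_monotone_0_pi_le) auto
    then have "sqrt 2 * cos (pi / 4) \<le> sqrt 2 * cos (\<phi> / 2)"
      by (intro mult_left_mono) auto
    moreover have "sqrt 2 * cos (pi / 4) = 1" by (simp add: cos_45)
    ultimately have "1 \<le> sqrt 2 * cos (\<phi> / 2)" by linarith
    then show ?thesis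
      using \<phi> \<open>\<phi> < pi\<close> K by (intro mult_right_mono mult_left_mono) (auto intro: sin_ge_zero)
  qed
  also have "\<dots> = sin \<phi> * (sqrt 2 * K)"
    using sin_double[of "\<phi> / 2"] by simp
  finally show ?thesis using sin_gt_zero[OF \<phi>(1) \<open>\<phi> < pi\<close>] by simp
qed

lemma near_mod_period:
  assumes "0 < (\<omega>::real)"
  obtains k :: int where "a \<le> \<beta> + of_int k * \<omega>" "\<beta> + of_int k * \<omega> \<le> a + \<omega>"
proof -
  obtain k :: int where "\<beta> - a + of_int k * \<omega> \<in> {0..\<omega>}"
    using reduce_mod_period[OF assms] by blast
  then show ?thesis by (intro that[of k]) auto
qed

lemma rho_TS_STRIP_le: "rho_TS f_STRIP \<le> ereal (sqrt 2)"
proof (rule rho_TS_le[of pi])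
  show "f_STRIP (dir (\<theta> + pi)) n P = f_STRIP (dir \<theta>) n P" for \<theta> n P
    by (simp add: dir_add_pi)
  show "0 \<le> f_STRIP \<alpha> n P" if "distinct_points n P" for \<alpha> n P
    using dir_cases[of \<alpha>] width_nonneg[OF distinct_points_pos[OF that]] by (metis f_STRIP_dir)
  show "f_STRIP \<alpha> n P = f_STRIP \<alpha> n Q" if "\<And>i. i < n \<Longrightarrow> P i = Q i" for \<alpha> n P Q
    using dir_cases[of \<alpha>] width_cong[of n P Q, OF that] by (metis f_STRIP_dir)
  show "continuous_on UNIV (\<lambda>(t, \<theta>). f_STRIP (dir \<theta>) n (\<lambda>i. p i t))"
    if "0 < n" "\<And>i. i < n \<Longrightarrow> continuous_on UNIV (p i)" for n and p :: "nat \<Rightarrow> real \<Rightarrow> plane"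
    unfolding f_STRIP_dir split_beta
    by (intro continuous_on_width continuous_intros that continuous_on_compose2[OF that(2)]) auto
  show "\<exists>k::int. \<forall>w\<in>closed_segment \<alpha> (\<beta> + of_int k * pi). f_STRIP (dir w) n P \<le> sqrt 2 * K"
    if P: "distinct_points n P" and le: "f_STRIP (dir \<alpha>) n P \<le> K" "f_STRIP (dir \<beta>) n P \<le> K" for n P K \<alpha> \<beta>
  proof -
    note n = distinct_points_pos[OF P]
    \<comment> \<open>Centring the period at \<open>\<alpha>\<close> selects a representative of
      \<open>\<beta>\<close> at most a right angle away, on either side.\<close>
    obtain k :: int where k: "\<alpha> - pi / 2 \<le> \<beta> + of_int k * pi" "\<beta> + of_int k * pi \<le> \<alpha> - pi / 2 + pi"
      by (rule near_mod_period[OF pi_gt_zero])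
    define \<beta>' where "\<beta>' = \<beta> + of_int k * pi"
    have le': "width n P (unit_vec (\<alpha> + pi / 2)) \<le> K" "width n P (unit_vec (\<beta>' + pi / 2)) \<le> K"
      using le width_unit_vec_periodic[of n P "\<beta> + pi / 2" k] by (simp_all add: f_STRIP_dir \<beta>'_def algebra_simps)
    have "f_STRIP (dir w) n P \<le> sqrt 2 * K" if "w \<in> closed_segment \<alpha> \<beta>'" for w
    proof (cases "\<alpha> \<le> \<beta>'")
      case True
      then show ?thesis
        using that k unfolding f_STRIP_dir \<beta>'_def[symmetric]
        by (intro width_between_le_sqrt2[OF n _ _ le']) (auto simp: closed_segment_eq_real_ivl)
    next
      case False
      then show ?thesis
        using that k unfolding f_STRIP_dir \<beta>'_def[symmetric]
        by (intro width_between_le_sqrt2[OF n _ _ le'(2,1)]) (auto simp: closed_segment_eq_real_ivl)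
    qed
    then show ?thesis unfolding \<beta>'_def by blast
  qed
  show "\<exists>k::int. \<beta> = \<alpha> + of_int k * pi"
    if "distinct_points n P" "f_STRIP (dir \<alpha>) n P = 0" "f_STRIP (dir \<beta>) n P = 0" for n P \<alpha> \<beta>
    using width_zeros_angle[OF that(1), of "\<alpha> + pi / 2" "\<beta> + pi / 2"] that by (auto simp: f_STRIP_dir)
qed auto

section \<open>Oriented bounding boxes\<close>

text \<open>Two boxes of equal area at angle \<open>\<phi>\<close> are compared, \<open>X\<close> and \<open>Y\<close> being the side lengths of one relative to the longest
  side of the other, with \<open>c = cos \<phi>\<close> and \<open>s = sin \<phi>\<close>.  The extremal case of the dichotomy is the
  3-4-5 angle with \<open>X = 1\<close>, \<open>Y = 1 / 2\<close>.\<close>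

lemma box_ratio_chord:
  fixes X c :: real
  assumes "1 / 2 \<le> X" "X \<le> 1" "0 \<le> c" "5 * c * X \<le> 2 * X\<^sup>2 - X + 2"
  shows "25 * c\<^sup>2 \<le> 16 - 7 * (2 * X\<^sup>2 - X)"
proof -
  have "(5 * c * X)\<^sup>2 \<le> (2 * X\<^sup>2 - X + 2)\<^sup>2"
    using assms by (intro power_mono) auto
  \<comment> \<open>The subtracted product vanishes at \<open>X = 1 / 2\<close> and
    \<open>X = 1\<close>. In the variable \<open>2 * X\<^sup>2 - X\<close> the bound is the chord
    through these two points, with values 16 and 9, that is \<open>c = 4 / 5\<close> and
    \<open>c = 3 / 5\<close>.\<close>
  also have "\<dots> = X\<^sup>2 * (16 - 7 * (2 * X\<^sup>2 - X)) - (1 - X) * (2 * X - 1) * (9 * X\<^sup>2 + 8 * X + 4)"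
    by algebra
  also have "\<dots> \<le> X\<^sup>2 * (16 - 7 * (2 * X\<^sup>2 - X))"
    using assms by simp
  finally have "X\<^sup>2 * (25 * c\<^sup>2) \<le> X\<^sup>2 * (16 - 7 * (2 * X\<^sup>2 - X))"
    by (simp add: power_mult_distrib algebra_simps)
  then show ?thesis using assms by (simp add: mult_le_cancel_left)
qed

text \<open>Let \<open>h\<close> be the sum of \<open>2 * X\<^sup>2 - X\<close> and
  \<open>2 * Y\<^sup>2 - Y\<close>. If the conclusion failed, adding the last two hypotheses would
  give \<open>h > 1\<close>, while adding the two chord bounds would give
  \<open>25 \<le> 32 - 7 * h\<close>.\<close>

lemma box_ratio_incompatible:
  fixes X Y c s :: real
  assumes "1 / 2 \<le> X" "X \<le> 1" "1 / 2 \<le> Y" "Y \<le> 1" "0 \<le> c" "0 \<le> s" "c\<^sup>2 + s\<^sup>2 = 1"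
    and "5 * c * X \<le> 2 * X\<^sup>2 - X + 2" "5 * s * Y < 2 * Y\<^sup>2 - Y + 2"
  shows "c * X + s * Y < 1"
proof (rule ccontr)
  assume "\<not> ?thesis"
  then have "1 < (2 * X\<^sup>2 - X) + (2 * Y\<^sup>2 - Y)" using assms(8,9) by linarith
  moreover have "25 * c\<^sup>2 \<le> 16 - 7 * (2 * X\<^sup>2 - X)" "25 * s\<^sup>2 \<le> 16 - 7 * (2 * Y\<^sup>2 - Y)"
    using box_ratio_chord[of X c] box_ratio_chord[of Y s] assms by auto
  moreover have "25 * c\<^sup>2 + 25 * s\<^sup>2 = 25" using assms(7) by simp
  ultimately show False by argo
qed

text \<open>Here \<open>c * X \<le> c\<close> forces \<open>Y\<close> to be at least
  \<open>\<tau> = (1 - c) / s\<close>, the tangent of the half angle. As \<open>y + 1 / y\<close>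
  decreases on (0, 1], \<open>Y + 1 / Y\<close> is at most
  \<open>\<tau> + 1 / \<tau> = 2 / s\<close>, and \<open>4 / s \<le> 5 * s + 1\<close> once
  \<open>s \<ge> 4 / 5\<close>.\<close>

lemma box_ratio_small_angle:
  fixes X Y c s :: real
  assumes "X \<le> 1" "Y \<le> 1" "0 \<le> c" "c < 3 / 5" "0 \<le> s" "c\<^sup>2 + s\<^sup>2 = 1" "1 \<le> c * X + s * Y"
  shows "2 * Y\<^sup>2 + 2 \<le> (5 * s + 1) * Y"
proof -
  have "c\<^sup>2 < (3 / 5)\<^sup>2" using assms by (intro power_strict_mono) auto
  then have "(4 / 5)\<^sup>2 < s\<^sup>2" using assms(6) by (simp add: power2_eq_square)
  then have s: "4 / 5 < s" using assms(5) by (rule power_less_imp_less_base)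
  define \<tau> where "\<tau> = (1 - c) / s"
  have \<tau>: "0 < \<tau>" using assms s by (simp add: \<tau>_def)
  have "c * X \<le> c" using assms by (simp add: mult_left_le)
  then have "\<tau> \<le> Y" using assms s by (simp add: \<tau>_def field_simps)
  have "s * \<tau> = 1 - c" using s by (simp add: \<tau>_def)
  then have "s * (s * (1 + \<tau>\<^sup>2)) = s * (2 * \<tau>)" using assms(6) by algebra
  then have \<tau>2: "s * (1 + \<tau>\<^sup>2) = 2 * \<tau>" using s by simp
  have "\<tau> \<le> 1" "0 < Y" using \<open>\<tau> \<le> Y\<close> assms \<tau> by auto
  then have "Y * \<tau> \<le> 1 * 1" using assms \<tau> by (intro mult_mono) auto
  \<comment> \<open>Monotonicity of \<open>y + 1 / y\<close> on (0, 1], with denominators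
    cleared.\<close>
  then have "0 \<le> (Y - \<tau>) * (1 - Y * \<tau>)" using \<open>\<tau> \<le> Y\<close> by simp
  then have "\<tau> * (2 * Y\<^sup>2 + 2) \<le> 2 * Y * (1 + \<tau>\<^sup>2)" by (simp add: algebra_simps power2_eq_square)
  then have "s * (\<tau> * (2 * Y\<^sup>2 + 2)) \<le> s * (2 * Y * (1 + \<tau>\<^sup>2))"
    using s by simp
  also have "\<dots> = 2 * Y * (2 * \<tau>)" using \<tau>2 by algebra
  also have "\<dots> \<le> s * (\<tau> * ((5 * s + 1) * Y))"
  proof -
    have "(4 / 5) * (4 / 5) \<le> s * s" using s by (intro mult_mono) auto
    then have "4 \<le> s * (5 * s + 1)" using s by (simp add: algebra_simps)
    then have "4 * (\<tau> * Y) \<le> s * (5 * s + 1) * (\<tau> * Y)"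
      using \<tau> \<open>0 < Y\<close> by (intro mult_right_mono) auto
    then show ?thesis by (simp add: algebra_simps)
  qed
  finally have "(s * \<tau>) * (2 * Y\<^sup>2 + 2) \<le> (s * \<tau>) * ((5 * s + 1) * Y)" by (simp add: mult.assoc)
  then show ?thesis using s \<tau> by (simp add: mult_le_cancel_left)
qed

text \<open>Unless \<open>c\<close> or \<open>s\<close> is below 3/5, both lie between 3/5 and 4/5,
  and failure of both alternatives contradicts \<open>box_ratio_incompatible\<close> after small
  ratios have been raised to 1/2.\<close>

lemma box_ratio_dichotomy:
  fixes X Y c s :: real
  assumes "X \<le> 1" "Y \<le> 1" "0 \<le> c" "0 \<le> s" "c\<^sup>2 + s\<^sup>2 = 1" "1 \<le> c * X + s * Y"
  shows "2 * X\<^sup>2 + 2 \<le> (5 * c + 1) * X \<or> 2 * Y\<^sup>2 + 2 \<le> (5 * s + 1) * Y"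
proof (cases "c < 3 / 5 \<or> s < 3 / 5")
  case True
  then show ?thesis
    using box_ratio_small_angle[of X Y c s] box_ratio_small_angle[of Y X s c] assms
    by (auto simp: add.commute)
next
  case False
  have le: "z \<le> 4 / 5" if "0 \<le> z" "3 / 5 \<le> z'" "z\<^sup>2 + z'\<^sup>2 = 1" for z z' :: real
  proof -
    have "(3 / 5)\<^sup>2 \<le> z'\<^sup>2" using that by (intro power_mono) auto
    then have "z\<^sup>2 \<le> (4 / 5)\<^sup>2" using that by (simp add: power2_eq_square)
    then show ?thesis by (rule power2_le_imp_le) simp
  qed
  have c: "c \<le> 4 / 5" and s: "s \<le> 4 / 5"
    using le[of c s] le[of s c] False assms by (auto simp: add.commute)
  show ?thesis
  proof (rule ccontr)
    assume "\<not> ?thesis"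
    then have *: "5 * c * X < 2 * X\<^sup>2 - X + 2" "5 * s * Y < 2 * Y\<^sup>2 - Y + 2"
      by (simp_all add: algebra_simps)
    consider "X < 1 / 2" "Y < 1 / 2" | "X < 1 / 2" "1 / 2 \<le> Y" | "1 / 2 \<le> X" "Y < 1 / 2" | "1 / 2 \<le> X" "1 / 2 \<le> Y"
      by linarith
    then show False
    proof cases
      case 1
      then have "c * X + s * Y \<le> c * (1 / 2) + s * (1 / 2)"
        using assms by (intro add_mono mult_left_mono) auto
      then show False using c s assms by linarith
    next
      \<comment> \<open>Raising \<open>X\<close> to 1/2 only increases \<open>c * X + s * Y\<close>;
        at \<open>X = 1 / 2\<close> the hypothesis on \<open>X\<close> in
        \<open>box_ratio_incompatible\<close> reads \<open>c \<le> 4 / 5\<close>.\<close>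
      case 2
      then have "c * X \<le> c * (1 / 2)" using assms by (intro mult_left_mono) auto
      moreover have "c * (1 / 2) + s * Y < 1"
        using 2 assms * c by (intro box_ratio_incompatible) (auto simp: power2_eq_square)
      ultimately show False using assms by linarith
    next
      case 3
      then have "s * Y \<le> s * (1 / 2)" using assms by (intro mult_left_mono) auto
      moreover have "s * (1 / 2) + c * X < 1"
        using 3 assms * s by (intro box_ratio_incompatible) (auto simp: power2_eq_square add.commute)
      ultimately show False using assms by linarith
    next
      case 4
      then have "c * X + s * Y < 1"
        using assms * by (intro box_ratio_incompatible) auto
      then show False using assms by linarith
    qed
  qed
qed

text \<open>Multiplying the first mixed sum by \<open>X = b / a\<close> turns it into
  \<open>b * b' + a * a' * X\<^sup>2\<close>, hence into the two areas, which \<open>K\<close>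
  bounds. The second is treated alike with \<open>Y = b' / a\<close>.\<close>

lemma box_cross_dichotomy_max:
  fixes a a' b b' c s K :: real
  assumes "0 \<le> a'" "0 \<le> b" "0 \<le> b'" and max: "a' \<le> a" "b \<le> a" "b' \<le> a"
    and cs: "0 \<le> c" "0 \<le> s" "c\<^sup>2 + s\<^sup>2 = 1" and K: "a * a' \<le> K" "b * b' \<le> K"
    and "a \<le> c * b + s * b'"
  shows "a * b' + a' * b \<le> K * (5 * c + 1) / 2 \<or> a' * b' + a * b \<le> K * (5 * s + 1) / 2"
proof (cases "a = 0")
  case True
  then have "b = 0" "b' = 0" "0 \<le> K" using assms by auto
  then show ?thesis using True cs by simp
next
  case False
  then have a: "0 < a" using assms by linarith
  define X where "X = b / a"
  define Y where "Y = b' / a"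
  have b: "b = a * X" "b' = a * Y" using a by (simp_all add: X_def Y_def)
  have XY: "X \<le> 1" "Y \<le> 1" "0 \<le> X" "0 \<le> Y" using a assms by (simp_all add: X_def Y_def)
  have "1 \<le> c * X + s * Y" using \<open>a \<le> c * b + s * b'\<close> a by (simp add: X_def Y_def field_simps)
  from box_ratio_dichotomy[OF XY(1,2) cs this]
  show ?thesis
  proof
    assume X: "2 * X\<^sup>2 + 2 \<le> (5 * c + 1) * X"
    then have "0 < X" using XY(3) by (cases "X = 0") auto
    have "0 \<le> K" using K(1) a assms(1) by (meson less_imp_le mult_nonneg_nonneg order_trans)
    have "(a * b' + a' * b) * X = b * b' + a * a' * X\<^sup>2" by (simp add: b algebra_simps power2_eq_square)
    also have "\<dots> \<le> K + K * X\<^sup>2" using K by (intro add_mono mult_right_mono) auto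
    also have "\<dots> = K * ((2 * X\<^sup>2 + 2) / 2)" by (simp add: algebra_simps)
    also have "\<dots> \<le> K * ((5 * c + 1) * X / 2)" using X \<open>0 \<le> K\<close> by (intro mult_left_mono) auto
    finally have "(a * b' + a' * b) * X \<le> (K * (5 * c + 1) / 2) * X" by simp
    then show ?thesis using \<open>0 < X\<close> by simp
  next
    assume Y: "2 * Y\<^sup>2 + 2 \<le> (5 * s + 1) * Y"
    then have "0 < Y" using XY(4) by (cases "Y = 0") auto
    have "0 \<le> K" using K(1) a assms(1) by (meson less_imp_le mult_nonneg_nonneg order_trans)
    have "(a' * b' + a * b) * Y = b * b' + a * a' * Y\<^sup>2" by (simp add: b algebra_simps power2_eq_square)
    also have "\<dots> \<le> K + K * Y\<^sup>2" using K by (intro add_mono mult_right_mono) auto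
    also have "\<dots> = K * ((2 * Y\<^sup>2 + 2) / 2)" by (simp add: algebra_simps)
    also have "\<dots> \<le> K * ((5 * s + 1) * Y / 2)" using Y \<open>0 \<le> K\<close> by (intro mult_left_mono) auto
    finally have "(a' * b' + a * b) * Y \<le> (K * (5 * s + 1) / 2) * Y" by simp
    then show ?thesis using \<open>0 < Y\<close> by simp
  qed
qed

text \<open>The first alternative serves the turn by \<open>\<phi>\<close>, the second the turn by
  the complementary angle, where the sides of one box trade places. Relabelling the sides puts the
  longest one into the role of \<open>a\<close>.\<close>

lemma box_cross_dichotomy:
  fixes a a' b b' c s K :: real
  assumes "0 \<le> a" "0 \<le> a'" "0 \<le> b" "0 \<le> b'"
    and cs: "0 \<le> c" "0 \<le> s" "c\<^sup>2 + s\<^sup>2 = 1" and K: "a * a' \<le> K" "b * b' \<le> K"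
    and "a \<le> c * b + s * b'" "a' \<le> c * b' + s * b" "b \<le> c * a + s * a'" "b' \<le> c * a' + s * a"
  shows "a * b' + a' * b \<le> K * (5 * c + 1) / 2 \<or> a' * b' + a * b \<le> K * (5 * s + 1) / 2"
proof -
  consider "a' \<le> a" "b \<le> a" "b' \<le> a" | "a \<le> a'" "b \<le> a'" "b' \<le> a'"
    | "a \<le> b" "a' \<le> b" "b' \<le> b" | "a \<le> b'" "a' \<le> b'" "b \<le> b'"
    by linarith
  then show ?thesis
  proof cases
    case 1
    then show ?thesis using assms by (intro box_cross_dichotomy_max) auto
  next
    case 2
    then show ?thesis using box_cross_dichotomy_max[of a b' b a' c s K] assms
      by (simp add: algebra_simps)
  next
    case 3
    then show ?thesis using box_cross_dichotomy_max[of b' a a' b c s K] assms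
      by (simp add: algebra_simps)
  next
    case 4
    then show ?thesis using box_cross_dichotomy_max[of b a' a b' c s K] assms
      by (simp add: algebra_simps)
  qed
qed

text \<open>Both sides are interpolated by \<open>width_between\<close> and multiplied. Of the
  factor \<open>(5 * cos \<phi> + 1) / 2\<close> in the mixed term, \<open>2 * cos \<phi>\<close> is
  used up by the sum of squares and \<open>(1 + cos \<phi>) / 2\<close> remains. It meets
  \<open>x * y \<le> (1 - cos \<phi>) / 2\<close>, so the excess is a quarter of
  \<open>(sin \<phi>)\<^sup>2\<close>: this is the origin of 5/4.\<close>

lemma box_area_between:
  assumes n: "0 < n" and \<phi>: "0 < \<phi>" "\<phi> < pi / 2" and s: "0 \<le> s" "s \<le> \<phi>"
    and \<alpha>: "width n P (unit_vec \<alpha>) * width n P (unit_vec (\<alpha> + pi / 2)) \<le> K"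
    and \<beta>: "width n P (unit_vec (\<alpha> + \<phi>)) * width n P (unit_vec (\<alpha> + \<phi> + pi / 2)) \<le> K"
    and cross: "width n P (unit_vec \<alpha>) * width n P (unit_vec (\<alpha> + \<phi> + pi / 2)) +
      width n P (unit_vec (\<alpha> + pi / 2)) * width n P (unit_vec (\<alpha> + \<phi>)) \<le> K * (5 * cos \<phi> + 1) / 2"
  shows "width n P (unit_vec (\<alpha> + s)) * width n P (unit_vec (\<alpha> + s + pi / 2)) \<le> 5 / 4 * K"
proof -
  define a where "a = width n P (unit_vec \<alpha>)"
  define a' where "a' = width n P (unit_vec (\<alpha> + pi / 2))"
  define b where "b = width n P (unit_vec (\<alpha> + \<phi>))"
  define b' where "b' = width n P (unit_vec (\<alpha> + \<phi> + pi / 2))"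
  define w where "w = width n P (unit_vec (\<alpha> + s))"
  define w' where "w' = width n P (unit_vec (\<alpha> + s + pi / 2))"
  define x where "x = sin (\<phi> - s)"
  define y where "y = sin s"
  have \<phi>': "\<phi> < pi" using \<phi> pi_gt_zero by linarith
  have sp: "0 < sin \<phi>" using \<phi> \<phi>' by (intro sin_gt_zero) auto
  have xy: "0 \<le> x" "0 \<le> y" using s \<phi>' by (auto simp: x_def y_def intro: sin_ge_zero)
  have nn: "0 \<le> a" "0 \<le> a'" "0 \<le> b" "0 \<le> b'" "0 \<le> w" "0 \<le> w'"
    using width_nonneg[OF n] by (auto simp: a_def a'_def b_def b'_def w_def w'_def)
  have K: "0 \<le> K" using \<alpha> nn unfolding a_def a'_def by (meson mult_nonneg_nonneg order_trans)
  have "sin \<phi> * w \<le> x * a + y * b"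
    using width_between[OF n \<phi>(1) \<phi>' s, of P \<alpha>] by (simp add: w_def a_def b_def x_def y_def)
  moreover have "sin \<phi> * w' \<le> x * a' + y * b'"
    using width_between[OF n \<phi>(1) \<phi>' s, of P "\<alpha> + pi / 2"]
    by (simp add: w'_def a'_def b'_def x_def y_def algebra_simps)
  ultimately have "(sin \<phi> * w) * (sin \<phi> * w') \<le> (x * a + y * b) * (x * a' + y * b')"
    using nn xy sp by (intro mult_mono) auto
  also have "\<dots> = x\<^sup>2 * (a * a') + y\<^sup>2 * (b * b') + (x * y) * (a * b' + a' * b)"
    by algebra
  also have "\<dots> \<le> x\<^sup>2 * K + y\<^sup>2 * K + (x * y) * (K * (5 * cos \<phi> + 1) / 2)"
    using \<alpha> \<beta> cross xy unfolding a_def a'_def b_def b'_def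
    by (intro add_mono mult_left_mono) auto
  also have "\<dots> = K * ((sin \<phi>)\<^sup>2 + (x * y) * ((1 + cos \<phi>) / 2))"
  proof -
    \<comment> \<open>Law of cosines for the triangle with angles \<open>\<phi> - s\<close>,
      \<open>s\<close> and \<open>pi - \<phi>\<close>, whose sides are proportional to
      \<open>x\<close>, \<open>y\<close> and \<open>sin \<phi>\<close>.\<close>
    have x: "x = sin \<phi> * cos s - cos \<phi> * y" by (simp add: x_def y_def sin_diff)
    have "(cos s)\<^sup>2 + y\<^sup>2 = 1" "(sin \<phi>)\<^sup>2 + (cos \<phi>)\<^sup>2 = 1" by (simp_all add: y_def)
    then have "x\<^sup>2 + y\<^sup>2 + 2 * x * y * cos \<phi> = (sin \<phi>)\<^sup>2" unfolding x by algebra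
    then have "x\<^sup>2 + y\<^sup>2 = (sin \<phi>)\<^sup>2 - 2 * x * y * cos \<phi>" by linarith
    then have "x\<^sup>2 * K + y\<^sup>2 * K = K * ((sin \<phi>)\<^sup>2 - 2 * x * y * cos \<phi>)" by (simp flip: distrib_right)
    then show ?thesis by (simp add: algebra_simps add_divide_distrib)
  qed
  also have "\<dots> \<le> K * ((sin \<phi>)\<^sup>2 + ((1 - cos \<phi>) / 2) * ((1 + cos \<phi>) / 2))"
  proof -
    have "cos ((\<phi> - s) - s) - cos ((\<phi> - s) + s) = 2 * (x * y)"
      unfolding x_def y_def by (simp only: cos_add cos_diff)
    then have "2 * (x * y) = cos ((\<phi> - s) - s) - cos \<phi>" by simp
    also have "\<dots> \<le> 1 - cos \<phi>" by (intro diff_right_mono cos_le_one)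
    finally have "x * y \<le> (1 - cos \<phi>) / 2" by simp
    moreover have "0 \<le> cos \<phi>" using \<phi> by (intro cos_ge_zero) auto
    ultimately show ?thesis using K by (intro mult_left_mono add_left_mono mult_right_mono) auto
  qed
  also have "\<dots> = K * ((sin \<phi>)\<^sup>2 * 5 / 4)"
  proof -
    have "(sin \<phi>)\<^sup>2 = (1 - cos \<phi>) * (1 + cos \<phi>)"
      unfolding sin_squared_eq by algebra
    then show ?thesis by simp
  qed
  finally have "(sin \<phi>)\<^sup>2 * (w * w') \<le> (sin \<phi>)\<^sup>2 * (5 / 4 * K)"
    by (simp add: power2_eq_square mult_ac)
  then show ?thesis using sp by (simp add: w_def w'_def)
qed

text \<open>Used with both signs of the angle, so that the sides of each of two boxes bound those of
  the other.\<close>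

lemma width_rotate:
  assumes "0 < n" "0 \<le> cos \<psi>"
  shows "width n P (unit_vec (\<theta> + \<psi>)) \<le> cos \<psi> * width n P (unit_vec \<theta>) + \<bar>sin \<psi>\<bar> * width n P (unit_vec (\<theta> + pi / 2))"
proof -
  define y where "y = (if 0 \<le> sin \<psi> then unit_vec (\<theta> + pi / 2) else - unit_vec (\<theta> + pi / 2))"
  have "unit_vec (\<theta> + \<psi>) = cos \<psi> *\<^sub>R unit_vec \<theta> + \<bar>sin \<psi>\<bar> *\<^sub>R y"
    by (auto simp: y_def plane_eq_iff cos_add sin_add)
  moreover have "width n P y = width n P (unit_vec (\<theta> + pi / 2))"
    by (simp add: y_def width_minus)
  ultimately show ?thesis
    using width_linear_combination[OF assms(1,2), of "\<bar>sin \<psi>\<bar>" P "unit_vec \<theta>" y] by simp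
qed

lemma f_OBB_periodic: "f_OBB (dir (\<theta> + pi / 2)) n P = f_OBB (dir \<theta>) n P"
proof -
  have "\<theta> + pi / 2 + pi / 2 = \<theta> + pi" by simp
  then show ?thesis by (simp only: f_OBB_dir unit_vec_add_pi width_minus mult.commute)
qed

lemma f_OBB_joined:
  assumes P: "distinct_points n P" and le: "f_OBB (dir \<alpha>) n P \<le> K" "f_OBB (dir \<beta>) n P \<le> K"
  shows "\<exists>k::int. \<forall>w\<in>closed_segment \<alpha> (\<beta> + of_int k * (pi / 2)). f_OBB (dir w) n P \<le> 5 / 4 * K"
proof -
  note n = distinct_points_pos[OF P]
  have K: "0 \<le> K" using le(1) width_nonneg[OF n] unfolding f_OBB_dir by (meson mult_nonneg_nonneg order_trans)
  obtain k :: int where k: "\<alpha> \<le> \<beta> + of_int k * (pi / 2)" "\<beta> + of_int k * (pi / 2) \<le> \<alpha> + pi / 2"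
    by (rule near_mod_period[OF pi_half_gt_zero])
  define \<gamma> where "\<gamma> = \<beta> + of_int k * (pi / 2)"
  define \<phi> where "\<phi> = \<gamma> - \<alpha>"
  have \<gamma>_le: "f_OBB (dir \<gamma>) n P \<le> K"
    using le(2) periodic_int[of "\<lambda>\<theta>. f_OBB (dir \<theta>) n P" "pi / 2", OF f_OBB_periodic] by (simp add: \<gamma>_def)
  have \<gamma>_eq: "\<gamma> = \<alpha> + \<phi>" by (simp add: \<phi>_def)
  \<comment> \<open>The shift by \<open>k - 1\<close> describes the turn in the opposite direction,
    through \<open>pi / 2 - \<phi>\<close>.\<close>
  have k': "\<beta> + of_int (k - 1) * (pi / 2) = \<gamma> - pi / 2" by (simp add: \<gamma>_def field_simps)
  consider "\<phi> = 0" | "\<phi> = pi / 2" | "0 < \<phi>" "\<phi> < pi / 2"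
    using k by (fastforce simp: \<phi>_def \<gamma>_def)
  then show ?thesis
  proof cases
    case 1
    then have "\<forall>w\<in>closed_segment \<alpha> \<gamma>. f_OBB (dir w) n P \<le> 5 / 4 * K" using le(1) K \<gamma>_eq by auto
    then show ?thesis unfolding \<gamma>_def by blast
  next
    case 2
    then have "\<gamma> - pi / 2 = \<alpha>" using \<gamma>_eq by simp
    then have "\<forall>w\<in>closed_segment \<alpha> (\<gamma> - pi / 2). f_OBB (dir w) n P \<le> 5 / 4 * K" using le(1) K by auto
    then show ?thesis unfolding k'[symmetric] by blast
  next
    case 3
    define a where "a = width n P (unit_vec \<alpha>)"
    define a' where "a' = width n P (unit_vec (\<alpha> + pi / 2))"
    define b where "b = width n P (unit_vec \<gamma>)"
    define b' where "b' = width n P (unit_vec (\<gamma> + pi / 2))"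
    note defs = a_def a'_def b_def b'_def
    have cs: "0 \<le> cos \<phi>" "0 \<le> sin \<phi>" using 3 by (auto intro!: cos_ge_zero sin_ge_zero)
    have half: "\<theta> + pi / 2 + pi / 2 = \<theta> + pi" for \<theta> :: real by simp
    have b2: "width n P (unit_vec (\<gamma> + pi / 2 + pi / 2)) = b" "width n P (unit_vec (\<alpha> + pi / 2 + pi / 2)) = a"
      unfolding half defs by (simp_all add: unit_vec_add_pi width_minus)
    have "a \<le> cos \<phi> * b + sin \<phi> * b'"
      using width_rotate[OF n, of "- \<phi>" P \<gamma>] cs by (simp add: defs \<gamma>_eq)
    moreover have "a' \<le> cos \<phi> * b' + sin \<phi> * b"
      using width_rotate[OF n, of "- \<phi>" P "\<gamma> + pi / 2"] cs b2 by (simp add: defs \<gamma>_eq algebra_simps)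
    moreover have "b \<le> cos \<phi> * a + sin \<phi> * a'"
      using width_rotate[OF n, of "\<phi>" P \<alpha>] cs by (simp add: defs \<gamma>_eq)
    moreover have "b' \<le> cos \<phi> * a' + sin \<phi> * a"
      using width_rotate[OF n, of "\<phi>" P "\<alpha> + pi / 2"] cs b2 by (simp add: defs \<gamma>_eq algebra_simps)
    moreover have "a * a' \<le> K" "b * b' \<le> K" using le(1) \<gamma>_le by (simp_all add: f_OBB_dir defs)
    moreover have "0 \<le> a" "0 \<le> a'" "0 \<le> b" "0 \<le> b'" using width_nonneg[OF n] by (simp_all add: defs)
    ultimately consider "a * b' + a' * b \<le> K * (5 * cos \<phi> + 1) / 2" | "a' * b' + a * b \<le> K * (5 * sin \<phi> + 1) / 2"
      using box_cross_dichotomy[of a a' b b' "cos \<phi>" "sin \<phi>" K] cs by fastforce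
    then show ?thesis
    proof cases
      case 1
      have "f_OBB (dir w) n P \<le> 5 / 4 * K" if "w \<in> closed_segment \<alpha> \<gamma>" for w
      proof -
        have "w \<in> {\<alpha>..\<gamma>}" using that 3 by (simp add: closed_segment_eq_real_ivl \<gamma>_eq)
        then show ?thesis
          using box_area_between[OF n 3, of "w - \<alpha>" P \<alpha> K] le(1) \<gamma>_le 1
          by (simp add: f_OBB_dir defs \<gamma>_eq)
      qed
      then show ?thesis unfolding \<gamma>_def by blast
    next
      case 2
      have eqs: "width n P (unit_vec (\<gamma> - pi / 2)) = b'"
        using width_unit_vec_periodic[of n P "\<gamma> - pi / 2" 1] by (simp add: defs add.commute)
      have "f_OBB (dir w) n P \<le> 5 / 4 * K" if "w \<in> closed_segment \<alpha> (\<gamma> - pi / 2)" for w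
      proof -
        have "w \<in> {\<gamma> - pi / 2..\<alpha>}" using that 3 by (simp add: closed_segment_eq_real_ivl \<gamma>_eq)
        moreover have "\<gamma> - pi / 2 + (pi / 2 - \<phi>) = \<alpha>" by (simp add: \<gamma>_eq)
        ultimately show ?thesis
          using box_area_between[OF n, of "pi / 2 - \<phi>" "w - (\<gamma> - pi / 2)" P "\<gamma> - pi / 2" K] le(1) \<gamma>_le 2 3
          by (simp add: f_OBB_dir eqs defs[symmetric] cos_diff mult.commute \<gamma>_eq[symmetric])
      qed
      then show ?thesis unfolding k'[symmetric] by blast
    qed
  qed
qed

lemma rho_TS_OBB_le: "rho_TS f_OBB \<le> ereal (5 / 4)"
proof (rule rho_TS_le[of "pi / 2"])
  show "f_OBB (dir (\<theta> + pi / 2)) n P = f_OBB (dir \<theta>) n P" for \<theta> n P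
    by (rule f_OBB_periodic)
  show "0 \<le> f_OBB \<alpha> n P" if "distinct_points n P" for \<alpha> n P
    using dir_cases[of \<alpha>] width_nonneg[OF distinct_points_pos[OF that]]
    by (metis f_OBB_dir mult_nonneg_nonneg)
  show "f_OBB \<alpha> n P = f_OBB \<alpha> n Q" if "\<And>i. i < n \<Longrightarrow> P i = Q i" for \<alpha> n P Q
    using dir_cases[of \<alpha>] width_cong[of n P Q, OF that] by (metis f_OBB_dir)
  show "continuous_on UNIV (\<lambda>(t, \<theta>). f_OBB (dir \<theta>) n (\<lambda>i. p i t))"
    if "0 < n" "\<And>i. i < n \<Longrightarrow> continuous_on UNIV (p i)" for n and p :: "nat \<Rightarrow> real \<Rightarrow> plane"
    unfolding f_OBB_dir split_beta
    by (intro continuous_on_width continuous_intros that continuous_on_compose2[OF that(2)]) auto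
  show "\<exists>k::int. \<forall>w\<in>closed_segment \<alpha> (\<beta> + of_int k * (pi / 2)). f_OBB (dir w) n P \<le> 5 / 4 * K"
    if "distinct_points n P" "f_OBB (dir \<alpha>) n P \<le> K" "f_OBB (dir \<beta>) n P \<le> K" for n P K \<alpha> \<beta>
    using that by (rule f_OBB_joined)
  show "\<exists>k::int. \<beta> = \<alpha> + of_int k * (pi / 2)"
    if P: "distinct_points n P" and zero: "f_OBB (dir \<alpha>) n P = 0" "f_OBB (dir \<beta>) n P = 0" for n P \<alpha> \<beta>
  proof -
    have zero_width: "\<exists>i::int. width n P (unit_vec (\<theta> + of_int i * (pi / 2))) = 0" if "f_OBB (dir \<theta>) n P = 0" for \<theta>
    proof (cases "width n P (unit_vec \<theta>) = 0")
      case True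
      then show ?thesis by (intro exI[of _ 0]) simp
    next
      case False
      then show ?thesis using that by (intro exI[of _ 1]) (simp add: f_OBB_dir)
    qed
    obtain i j :: int where "width n P (unit_vec (\<alpha> + of_int i * (pi / 2))) = 0"
      "width n P (unit_vec (\<beta> + of_int j * (pi / 2))) = 0"
      using zero_width zero by blast
    then obtain k :: int where "\<beta> + of_int j * (pi / 2) = \<alpha> + of_int i * (pi / 2) + of_int k * pi"
      using width_zeros_angle[OF P] by blast
    then show ?thesis by (intro exI[of _ "i - j + 2 * k"]) (simp add: field_simps)
  qed
qed auto

section \<open>First principal component\<close>

lemma infdist_line:
  fixes p c v :: plane
  assumes v: "norm v = 1"
  shows "infdist p {c + s *\<^sub>R v | s. True} = \<bar>(p - c) \<bullet> rot90 v\<bar>"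
proof (rule antisym)
  have v1: "(v $ 1)\<^sup>2 + (v $ 2)\<^sup>2 = 1" using v by (simp add: norm_plane)
  have rot: "rot90 v $ 1 = - (v $ 2)" "rot90 v $ 2 = v $ 1" by (simp_all add: rot90_def)
  let ?L = "{c + s *\<^sub>R v | s. True}"
  define s where "s = (p - c) \<bullet> v"
  have "p - (c + s *\<^sub>R v) = ((p - c) \<bullet> rot90 v) *\<^sub>R rot90 v"
  proof -
    define x where "x = (p - c) $ 1"
    define y where "y = (p - c) $ 2"
    have "x - (x * v $ 1 + y * v $ 2) * v $ 1 = (- x * v $ 2 + y * v $ 1) * - v $ 2"
      "y - (x * v $ 1 + y * v $ 2) * v $ 2 = (- x * v $ 2 + y * v $ 1) * v $ 1"
      using v1 by algebra+
    then show ?thesis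
      by (simp add: plane_eq_iff inner_plane rot s_def x_def y_def algebra_simps)
  qed
  then have "dist p (c + s *\<^sub>R v) = \<bar>(p - c) \<bullet> rot90 v\<bar>"
    using v by (simp add: dist_norm norm_rot90)
  then show "infdist p ?L \<le> \<bar>(p - c) \<bullet> rot90 v\<bar>"
    using infdist_le[of "c + s *\<^sub>R v" ?L p] by auto
  have "\<bar>(p - c) \<bullet> rot90 v\<bar> \<le> dist p a" if aL: "a \<in> ?L" for a
  proof -
    obtain s where a: "a = c + s *\<^sub>R v" using aL by auto
    have "v \<bullet> rot90 v = 0" by (simp add: inner_plane rot)
    then have "(p - a) \<bullet> rot90 v = (p - c) \<bullet> rot90 v"
      by (simp add: a inner_diff_left inner_add_left)
    then show ?thesis
      using Cauchy_Schwarz_ineq2[of "p - a" "rot90 v"] v by (simp add: dist_norm norm_rot90)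
  qed
  then show "\<bar>(p - c) \<bullet> rot90 v\<bar> \<le> infdist p ?L"
    unfolding infdist_def by (auto intro!: cINF_greatest)
qed

definition centroid :: "nat \<Rightarrow> (nat \<Rightarrow> plane) \<Rightarrow> plane" where
  "centroid n P = (1 / real n) *\<^sub>R (\<Sum>i<n. P i)"

text \<open>Parallel axis identity: the deviations from the centroid sum to 0, so the mixed term
  drops out.\<close>

lemma sum_squares_centroid_le:
  assumes "0 < n"
  shows "(\<Sum>i<n. ((P i - centroid n P) \<bullet> r)\<^sup>2) \<le> (\<Sum>i<n. ((P i - c) \<bullet> r)\<^sup>2)"
proof -
  define m where "m = (centroid n P - c) \<bullet> r"
  define q where "q i = (P i - centroid n P) \<bullet> r" for i
  have "(\<Sum>i<n. P i - centroid n P) = 0"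
    using assms by (simp add: sum_subtractf centroid_def sum_constant_scaleR del: sum_constant)
  then have q: "(\<Sum>i<n. q i) = 0"
    unfolding q_def by (simp flip: inner_sum_left)
  have "((P i - c) \<bullet> r)\<^sup>2 = (q i)\<^sup>2 + 2 * m * q i + m\<^sup>2" for i
    by (simp add: q_def m_def power2_eq_square algebra_simps)
  then have "(\<Sum>i<n. ((P i - c) \<bullet> r)\<^sup>2) = (\<Sum>i<n. (q i)\<^sup>2) + real n * m\<^sup>2"
    using q by (simp add: sum.distrib flip: sum_distrib_left)
  then show ?thesis by (simp add: q_def)
qed

lemma f_PC_dir:
  assumes "0 < n"
  shows "f_PC (dir \<theta>) n P = (\<Sum>i<n. ((P i - centroid n P) \<bullet> unit_vec (\<theta> + pi / 2))\<^sup>2)"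
proof -
  let ?v = "unit_vec \<theta>"
  let ?line = "\<lambda>c. {c + s *\<^sub>R ?v | s. True}"
  have lines: "lines (dir \<theta>) = range ?line"
    unfolding dir_def by (subst lines.abs_eq) (auto simp: eq_onp_def)
  have cost: "(\<Sum>i<n. (infdist (P i) (?line c))\<^sup>2) = (\<Sum>i<n. ((P i - c) \<bullet> unit_vec (\<theta> + pi / 2))\<^sup>2)" for c
    by (simp only: infdist_line[OF norm_unit_vec] rot90_unit_vec power2_abs)
  show ?thesis
    unfolding f_PC_def lines
  proof (rule cInf_eq_minimum)
    show "(\<Sum>i<n. ((P i - centroid n P) \<bullet> unit_vec (\<theta> + pi / 2))\<^sup>2) \<in> (\<lambda>L. \<Sum>i<n. (infdist (P i) L)\<^sup>2) ` range ?line"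
      using cost[of "centroid n P"] by (intro image_eqI[of _ _ "?line (centroid n P)"]) auto
    show "(\<Sum>i<n. ((P i - centroid n P) \<bullet> unit_vec (\<theta> + pi / 2))\<^sup>2) \<le> x"
      if x: "x \<in> (\<lambda>L. \<Sum>i<n. (infdist (P i) L)\<^sup>2) ` range ?line" for x
    proof -
      obtain c where "x = (\<Sum>i<n. (infdist (P i) (?line c))\<^sup>2)" using x by blast
      then show ?thesis using sum_squares_centroid_le[OF assms] by (simp only: cost)
    qed
  qed
qed

text \<open>The cost is a quadratic form in a unit vector. \<open>A\<close> is half the trace of the
  scatter matrix, and \<open>z\<close> is half the sum of the squares of the centred points as
  complex numbers. Nonnegativity of the cost at angle \<open>\<psi> / 2\<close> gives
  \<open>R \<le> A\<close>.\<close>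

lemma f_PC_sinusoid:
  assumes P: "distinct_points n P"
  shows "\<exists>A R \<psi>. 0 < A \<and> 0 \<le> R \<and> R \<le> A \<and> (\<forall>\<theta>. f_PC (dir \<theta>) n P = A - R * cos (2 * \<theta> - \<psi>))"
proof -
  note n = distinct_points_pos[OF P]
  define a where "a i = (P i - centroid n P) $ 1" for i
  define b where "b i = (P i - centroid n P) $ 2" for i
  define A where "A = (\<Sum>i<n. ((a i)\<^sup>2 + (b i)\<^sup>2) / 2)"
  define z where "z = Complex (\<Sum>i<n. ((a i)\<^sup>2 - (b i)\<^sup>2) / 2) (\<Sum>i<n. a i * b i)"
  have z: "Re z = cmod z * cos (Arg z)" "Im z = cmod z * sin (Arg z)"
    using rcis_cmod_Arg[of z] by (metis Re_rcis, metis Im_rcis)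
  have f: "f_PC (dir \<theta>) n P = A - cmod z * cos (2 * \<theta> - Arg z)" for \<theta>
  proof -
    have "((P i - centroid n P) \<bullet> unit_vec (\<theta> + pi / 2))\<^sup>2 =
        ((a i)\<^sup>2 + (b i)\<^sup>2) / 2 - (((a i)\<^sup>2 - (b i)\<^sup>2) / 2 * cos (2 * \<theta>) + a i * b i * sin (2 * \<theta>))" for i
    proof -
      have "((P i - centroid n P) \<bullet> unit_vec (\<theta> + pi / 2))\<^sup>2 = (b i * cos \<theta> - a i * sin \<theta>)\<^sup>2"
        by (simp add: inner_plane a_def b_def cos_add sin_add)
      moreover have "cos (2 * \<theta>) = (cos \<theta>)\<^sup>2 - (sin \<theta>)\<^sup>2" "sin (2 * \<theta>) = 2 * sin \<theta> * cos \<theta>"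
        by (simp_all add: cos_double sin_double)
      moreover have "(sin \<theta>)\<^sup>2 + (cos \<theta>)\<^sup>2 = 1" by simp
      ultimately show ?thesis by algebra
    qed
    then have "f_PC (dir \<theta>) n P = A - (Re z * cos (2 * \<theta>) + Im z * sin (2 * \<theta>))"
      unfolding f_PC_dir[OF n] A_def z_def
      by (simp add: sum_subtractf sum.distrib sum_distrib_right)
    also have "\<dots> = A - cmod z * cos (2 * \<theta> - Arg z)"
      by (subst z(1), subst z(2)) (simp add: cos_diff algebra_simps)
    finally show ?thesis .
  qed
  have "0 \<le> f_PC (dir (Arg z / 2)) n P"
    unfolding f_PC_dir[OF n] by (intro sum_nonneg) auto
  then have "cmod z \<le> A" unfolding f by simp
  moreover have "0 < A"
  proof -
    have "\<exists>i<n. P i \<noteq> centroid n P" using P unfolding distinct_points_def by metis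
    then obtain i where "i < n" "P i \<noteq> centroid n P" by blast
    then have "0 < ((a i)\<^sup>2 + (b i)\<^sup>2) / 2"
      using plane_eq_iff[of "P i" "centroid n P"] by (auto simp: a_def b_def sum_power2_gt_zero_iff)
    then show ?thesis unfolding A_def using \<open>i < n\<close> by (intro sum_pos2[of _ i]) auto
  qed
  ultimately show ?thesis using f by (intro exI[of _ A] exI[of _ "cmod z"] exI[of _ "Arg z"]) auto
qed

lemma rho_TS_PC_le: "rho_TS f_PC \<le> ereal 1"
proof (rule rho_TS_le[of pi])
  show "f_PC (dir (\<theta> + pi)) n P = f_PC (dir \<theta>) n P" for \<theta> n P
    by (simp add: dir_add_pi)
  show "0 \<le> f_PC \<alpha> n P" if "distinct_points n P" for \<alpha> n P
    using dir_cases[of \<alpha>] f_PC_dir[OF distinct_points_pos[OF that]]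
    by (metis (no_types, lifting) sum_nonneg zero_le_power2)
  show "f_PC \<alpha> n P = f_PC \<alpha> n Q" if "\<And>i. i < n \<Longrightarrow> P i = Q i" for \<alpha> n P Q
    using that by (simp add: f_PC_def)
  show "continuous_on UNIV (\<lambda>(t, \<theta>). f_PC (dir \<theta>) n (\<lambda>i. p i t))"
    if n: "0 < n" and cp: "\<And>i. i < n \<Longrightarrow> continuous_on UNIV (p i)" for n and p :: "nat \<Rightarrow> real \<Rightarrow> plane"
  proof -
    have p: "continuous_on UNIV (\<lambda>x :: real \<times> real. p i (fst x))" if "i < n" for i
      by (rule continuous_on_compose2[OF cp[OF that]]) (auto intro: continuous_intros)
    show ?thesis
      unfolding f_PC_dir[OF n] split_beta centroid_def
      by (intro continuous_on_sum continuous_on_power continuous_on_inner continuous_on_diff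
          continuous_on_scaleR continuous_on_const continuous_on_unit_vec continuous_on_add
          continuous_on_snd continuous_on_id p) auto
  qed
  show "\<exists>k::int. \<forall>w\<in>closed_segment \<alpha> (\<beta> + of_int k * pi). f_PC (dir w) n P \<le> 1 * K"
    if P: "distinct_points n P" and le: "f_PC (dir \<alpha>) n P \<le> K" "f_PC (dir \<beta>) n P \<le> K" for n P K \<alpha> \<beta>
  proof -
    obtain A R \<psi> where f: "0 \<le> R" and f': "\<forall>\<theta>. f_PC (dir \<theta>) n P = A - R * cos (2 * \<theta> - \<psi>)"
      using f_PC_sinusoid[OF P] by blast
    \<comment> \<open>Both angles are moved into the period centred at the minimum
      \<open>\<psi> / 2\<close>. There the cost grows with
      \<open>\<bar>2 * \<theta> - \<psi>\<bar>\<close>, so its maximum on a segment is at an end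
      point.\<close>
    obtain i :: int where i: "(\<psi> - pi) / 2 \<le> \<alpha> + of_int i * pi" "\<alpha> + of_int i * pi \<le> (\<psi> - pi) / 2 + pi"
      by (rule near_mod_period[OF pi_gt_zero])
    obtain j :: int where j: "(\<psi> - pi) / 2 \<le> \<beta> + of_int j * pi" "\<beta> + of_int j * pi \<le> (\<psi> - pi) / 2 + pi"
      by (rule near_mod_period[OF pi_gt_zero])
    have per: "f_PC (dir (\<theta> + of_int k * pi)) n P = f_PC (dir \<theta>) n P" for \<theta> and k :: int
      by (rule periodic_int) (simp add: dir_add_pi)
    have mono: "f_PC (dir x) n P \<le> f_PC (dir y) n P" if "\<bar>2 * x - \<psi>\<bar> \<le> \<bar>2 * y - \<psi>\<bar>" "\<bar>2 * y - \<psi>\<bar> \<le> pi" for x y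
    proof -
      have "cos \<bar>2 * y - \<psi>\<bar> \<le> cos \<bar>2 * x - \<psi>\<bar>" using that by (intro cos_monotone_0_pi_le) auto
      then show ?thesis using f f' by (simp add: mult_left_mono)
    qed
    have "f_PC (dir w) n P \<le> K" if w: "w \<in> closed_segment \<alpha> (\<beta> + of_int (j - i) * pi)" for w
    proof -
      define x where "x = w + of_int i * pi"
      define \<alpha>' where "\<alpha>' = \<alpha> + of_int i * pi"
      define \<beta>' where "\<beta>' = \<beta> + of_int j * pi"
      have "x \<in> closed_segment \<alpha>' \<beta>'"
        using w by (auto simp: x_def \<alpha>'_def \<beta>'_def closed_segment_eq_real_ivl algebra_simps split: if_splits)
      then consider "\<bar>2 * x - \<psi>\<bar> \<le> \<bar>2 * \<alpha>' - \<psi>\<bar>" | "\<bar>2 * x - \<psi>\<bar> \<le> \<bar>2 * \<beta>' - \<psi>\<bar>"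
        by (fastforce simp: closed_segment_eq_real_ivl split: if_splits)
      moreover have "\<bar>2 * \<alpha>' - \<psi>\<bar> \<le> pi" "\<bar>2 * \<beta>' - \<psi>\<bar> \<le> pi"
        using i j by (auto simp: \<alpha>'_def \<beta>'_def abs_le_iff field_simps)
      ultimately have "f_PC (dir x) n P \<le> f_PC (dir \<alpha>') n P \<or> f_PC (dir x) n P \<le> f_PC (dir \<beta>') n P"
        using mono by blast
      then show ?thesis using le by (auto simp: x_def \<alpha>'_def \<beta>'_def per)
    qed
    then have "\<forall>w\<in>closed_segment \<alpha> (\<beta> + of_int (j - i) * pi). f_PC (dir w) n P \<le> 1 * K" by simp
    then show ?thesis by blast
  qed
  show "\<exists>k::int. \<beta> = \<alpha> + of_int k * pi"
    if P: "distinct_points n P" and zero: "f_PC (dir \<alpha>) n P = 0" "f_PC (dir \<beta>) n P = 0" for n P \<alpha> \<beta>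
  proof -
    obtain A R \<psi> where f: "0 < A" "0 \<le> R" "R \<le> A" "\<forall>\<theta>. f_PC (dir \<theta>) n P = A - R * cos (2 * \<theta> - \<psi>)"
      using f_PC_sinusoid[OF P] by blast
    have one: "\<exists>k::int. 2 * \<theta> - \<psi> = of_int k * (2 * pi)" if "f_PC (dir \<theta>) n P = 0" for \<theta>
    proof -
      have "A = R * cos (2 * \<theta> - \<psi>)" using that f(4) by simp
      moreover have "R * cos (2 * \<theta> - \<psi>) \<le> R * 1" using f(2) by (intro mult_left_mono) auto
      ultimately have "R = A" using f(3) by simp
      with \<open>A = R * cos (2 * \<theta> - \<psi>)\<close> have "cos (2 * \<theta> - \<psi>) = 1" using f(1) by simp
      then show ?thesis by (auto simp: cos_one_2pi_int)
    qed
    obtain i j :: int where "2 * \<alpha> - \<psi> = of_int i * (2 * pi)" "2 * \<beta> - \<psi> = of_int j * (2 * pi)"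
      using one zero by blast
    then show ?thesis by (intro exI[of _ "j - i"]) (simp add: algebra_simps)
  qed
qed auto

section \<open>Lower bounds\<close>

text \<open>\<open>rep_orientation\<close> picks one of two opposite vectors with no regard to
  continuity; evenness hides the choice, and the quotient topology supplies continuity.\<close>

lemma even_function_on_orientations:
  fixes g :: "plane \<Rightarrow> real"
  assumes cont: "continuous_on (sphere 0 1) g" and even: "\<And>v. g (- v) = g v"
  obtains q where "continuous_on UNIV q" "\<And>v. norm v = 1 \<Longrightarrow> q (orientation_of v) = g v"
proof
  have q: "g (rep_orientation (orientation_of v)) = g v" if "norm v = 1" for v
    using Quotient_rep_abs[OF Quotient_orientation, of v] that even by auto
  then show "g (rep_orientation (orientation_of v)) = g v" if "norm v = 1" for v
    using that .
  show "continuous_on UNIV (\<lambda>\<alpha>. g (rep_orientation \<alpha>))"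
    unfolding continuous_on_open_vimage[OF open_UNIV]
  proof (intro allI impI)
    fix B :: "real set" assume "open B"
    have "{v \<in> sphere 0 1. orientation_of v \<in> (\<lambda>\<alpha>. g (rep_orientation \<alpha>)) -` B \<inter> UNIV} = sphere 0 1 \<inter> g -` B"
      using q by auto
    moreover have "openin (top_of_set (sphere 0 1)) (sphere 0 1 \<inter> g -` B)"
      using cont \<open>open B\<close> by (rule continuous_openin_preimage_gen)
    ultimately show "open ((\<lambda>\<alpha>. g (rep_orientation \<alpha>)) -` B \<inter> UNIV)"
      by (simp add: open_orientation_def)
  qed
qed

text \<open>A curve that is cheap at both ends starts where \<open>g\<close> is positive and ends
  where it is negative. By the intermediate value theorem it meets the zero set of \<open>g\<close>,
  which is expensive at all times.\<close>

lemma rho_TS_ge_barrier: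
  fixes g :: "plane \<Rightarrow> real"
  assumes m: "moving_point_set n T p"
    and g: "continuous_on (sphere 0 1) g" "\<And>v. g (- v) = g v"
    and start: "\<And>v. norm v = 1 \<Longrightarrow> g v \<le> 0 \<Longrightarrow> ereal c \<le> cost_ratio f (orientation_of v) n (\<lambda>i. p i 0)"
    and final: "\<And>v. norm v = 1 \<Longrightarrow> 0 \<le> g v \<Longrightarrow> ereal c \<le> cost_ratio f (orientation_of v) n (\<lambda>i. p i T)"
    and middle: "\<And>v t. norm v = 1 \<Longrightarrow> g v = 0 \<Longrightarrow> t \<in> {0..T} \<Longrightarrow>
      ereal c \<le> cost_ratio f (orientation_of v) n (\<lambda>i. p i t)"
  shows "ereal c \<le> rho_TS f"
proof (rule rho_TS_ge[OF m])
  fix a :: "real \<Rightarrow> orientation" assume a: "continuous_on {0..T} a"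
  have T: "0 < T" using m by (simp add: moving_point_set_def)
  obtain q where q: "continuous_on UNIV q" "\<And>v. norm v = 1 \<Longrightarrow> q (orientation_of v) = g v"
    using even_function_on_orientations[OF g] by blast
  have cont: "continuous_on {0..T} (\<lambda>t. q (a t))"
    by (rule continuous_on_compose2[OF q(1) a]) simp
  consider "q (a 0) \<le> 0" | "0 \<le> q (a T)" | "0 < q (a 0)" "q (a T) < 0" by linarith
  then show "\<exists>t\<in>{0..T}. ereal c \<le> cost_ratio f (a t) n (\<lambda>i. p i t)"
  proof cases
    case 1
    obtain v where "norm v = 1" "a 0 = orientation_of v" by (rule orientation_cases)
    then have "ereal c \<le> cost_ratio f (a 0) n (\<lambda>i. p i 0)" using start[of v] q(2) 1 by simp
    then show ?thesis using T by force
  next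
    case 2
    obtain v where "norm v = 1" "a T = orientation_of v" by (rule orientation_cases)
    then have "ereal c \<le> cost_ratio f (a T) n (\<lambda>i. p i T)" using final[of v] q(2) 2 by simp
    then show ?thesis using T by force
  next
    case 3
    then obtain t where t: "t \<in> {0..T}" "q (a t) = 0"
      using IVT2'[of "\<lambda>t. q (a t)" T 0 0] cont T by auto
    obtain v where "norm v = 1" "a t = orientation_of v" by (rule orientation_cases)
    then have "ereal c \<le> cost_ratio f (a t) n (\<lambda>i. p i t)" using middle[of v t] q(2) t by simp
    then show ?thesis using t by blast
  qed
qed

lemma cost_ratio_ge_1:
  assumes nonneg: "\<And>\<alpha>. 0 \<le> f \<alpha> n P"
  shows "1 \<le> cost_ratio f \<alpha> n P"
proof (cases "f \<alpha> n P = 0")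
  case True
  have "bdd_below (range (\<lambda>\<gamma>. f \<gamma> n P))" using nonneg by (intro bdd_belowI2[of _ 0]) simp
  then have "(INF \<gamma>. f \<gamma> n P) \<le> f \<alpha> n P" by (rule cINF_lower) simp
  moreover have "0 \<le> (INF \<gamma>. f \<gamma> n P)" using nonneg by (intro cINF_greatest) auto
  ultimately show ?thesis using True by (simp add: cost_ratio_def)
next
  case False
  then show ?thesis
    using cost_ratio_ge[of f n P 1 \<alpha> \<alpha>] nonneg less_le by (fastforce simp: one_ereal_def)
qed

lemma width_ge_abs: "i < n \<Longrightarrow> j < n \<Longrightarrow> \<bar>(P i - P j) \<bullet> x\<bar> \<le> width n P x"
  using width_ge[of i n j P x] width_ge[of j n i P x] by (simp add: abs_le_iff inner_diff_left)

lemma width_le_twice: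
  assumes "0 < n" "\<And>i. i < n \<Longrightarrow> \<bar>P i \<bullet> x\<bar> \<le> m"
  shows "width n P x \<le> 2 * m"
proof (rule width_le[OF assms(1)])
  fix i j assume "i < n" "j < n"
  then show "(P i - P j) \<bullet> x \<le> 2 * m"
    using assms(2)[of i] assms(2)[of j] by (simp add: inner_diff_left)
qed

lemma f_STRIP_orientation_of: "norm v = 1 \<Longrightarrow> f_STRIP (orientation_of v) n P = width n P (rot90 v)"
  by (simp add: f_STRIP_def perp_orientation_of extent_orientation_of norm_rot90)

lemma f_OBB_orientation_of:
  "norm v = 1 \<Longrightarrow> f_OBB (orientation_of v) n P = width n P v * width n P (rot90 v)"
  by (simp add: f_OBB_def perp_orientation_of extent_orientation_of norm_rot90)

lemma f_STRIP_nonneg: "0 < n \<Longrightarrow> 0 \<le> f_STRIP \<alpha> n P"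
  using orientation_cases[of \<alpha>] by (metis f_STRIP_orientation_of width_nonneg)

lemma f_OBB_nonneg: "0 < n \<Longrightarrow> 0 \<le> f_OBB \<alpha> n P"
  using orientation_cases[of \<alpha>] by (metis f_OBB_orientation_of width_nonneg mult_nonneg_nonneg)

lemma f_PC_nonneg: "0 < n \<Longrightarrow> 0 \<le> f_PC \<alpha> n P"
  using dir_cases[of \<alpha>] f_PC_dir by (metis (no_types, lifting) sum_nonneg zero_le_power2)

lemma rot90_nth [simp]: "rot90 v $ 1 = - (v $ 2)" "rot90 v $ 2 = v $ 1"
  by (simp_all add: rot90_def)

lemma less_4_cases: "(i::nat) < 4 \<Longrightarrow> i = 0 \<or> i = 1 \<or> i = 2 \<or> i = 3"
  by linarith

text \<open>Half sides \<open>2 - t\<close> and \<open>1 + t\<close>; corners 0 and 3 are opposite,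
  and so are 1 and 2.\<close>

definition rectangle :: "nat \<Rightarrow> real \<Rightarrow> plane" where
  "rectangle i t = vector [if i = 0 \<or> i = 2 then 2 - t else t - 2, if i = 0 \<or> i = 1 then 1 + t else - 1 - t]"

lemma rectangle_nth [simp]:
  "rectangle i t $ 1 = (if i = 0 \<or> i = 2 then 2 - t else t - 2)"
  "rectangle i t $ 2 = (if i = 0 \<or> i = 1 then 1 + t else - 1 - t)"
  by (simp_all add: rectangle_def)

lemma moving_rectangle: "moving_point_set 4 1 rectangle"
  unfolding moving_point_set_def
proof (intro conjI allI impI ballI)
  show "continuous_on {0..1} (rectangle i)" for i
    unfolding rectangle_def by (cases "i = 0"; cases "i = 1"; cases "i = 2") (auto intro!: continuous_intros)
  fix t :: real assume "t \<in> {0..1}"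
  then have "rectangle 0 t \<noteq> rectangle 3 t" by (simp add: plane_eq_iff)
  then show "\<exists>i<4. \<exists>j<4. rectangle i t \<noteq> rectangle j t"
    by (intro exI[of _ 0] exI[of _ 3] conjI) auto
qed simp

text \<open>The diagonal that fits the signs of \<open>v\<close> bounds the cost from below; the
  strip along the longer side, of width \<open>2 * min (2 - t) (1 + t)\<close>, bounds the optimum
  from above.\<close>

lemma rectangle_ratio:
  assumes v: "norm v = 1" and t: "t \<in> {0..1}"
    and le: "sqrt 2 * min (2 - t) (1 + t) \<le> (2 - t) * \<bar>v $ 2\<bar> + (1 + t) * \<bar>v $ 1\<bar>"
  shows "ereal (sqrt 2) \<le> cost_ratio f_STRIP (orientation_of v) 4 (\<lambda>i. rectangle i t)"
proof -
  let ?P = "\<lambda>i. rectangle i t"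
  have nn: "(2 - t) * \<bar>v $ 2\<bar> = \<bar>(2 - t) * v $ 2\<bar>" "(1 + t) * \<bar>v $ 1\<bar> = \<bar>(1 + t) * v $ 1\<bar>"
    using t by (simp_all add: abs_mult)
  have "\<bar>(?P 0 - ?P 3) \<bullet> rot90 v\<bar> \<le> width 4 ?P (rot90 v)" "\<bar>(?P 1 - ?P 2) \<bullet> rot90 v\<bar> \<le> width 4 ?P (rot90 v)"
    using width_ge_abs[of _ 4 _ ?P "rot90 v"] by auto
  then have "2 * ((2 - t) * \<bar>v $ 2\<bar> + (1 + t) * \<bar>v $ 1\<bar>) \<le> width 4 ?P (rot90 v)"
    unfolding nn by (simp add: inner_plane algebra_simps abs_if split: if_splits)
  then have ge: "2 * sqrt 2 * min (2 - t) (1 + t) \<le> f_STRIP (orientation_of v) 4 ?P"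
    using le v by (simp add: f_STRIP_orientation_of)
  obtain u :: plane where u: "norm u = 1" "width 4 ?P (rot90 u) \<le> 2 * min (2 - t) (1 + t)"
  proof (cases "2 - t \<le> 1 + t")
    case True
    have "width 4 ?P (rot90 (vector [0, 1])) \<le> 2 * (2 - t)"
      using t by (intro width_le_twice) (auto simp: inner_plane)
    then show ?thesis using True by (intro that[of "vector [0, 1]"]) (simp_all add: norm_plane)
  next
    case False
    have "width 4 ?P (rot90 (vector [1, 0])) \<le> 2 * (1 + t)"
      using t by (intro width_le_twice) (auto simp: inner_plane)
    then show ?thesis using False by (intro that[of "vector [1, 0]"]) (simp_all add: norm_plane)
  qed
  have "sqrt 2 * f_STRIP (orientation_of u) 4 ?P \<le> sqrt 2 * (2 * min (2 - t) (1 + t))"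
    using u by (intro mult_left_mono) (simp_all add: f_STRIP_orientation_of)
  also have "\<dots> = 2 * sqrt 2 * min (2 - t) (1 + t)" by simp
  also note ge
  finally have "sqrt 2 * f_STRIP (orientation_of u) 4 ?P \<le> f_STRIP (orientation_of v) 4 ?P" .
  moreover have "0 < 2 * sqrt 2 * min (2 - t) (1 + t)" using t by simp
  then have "0 < f_STRIP (orientation_of v) 4 ?P" using ge by linarith
  ultimately show ?thesis
    using cost_ratio_ge[of f_STRIP 4 ?P "sqrt 2"] f_STRIP_nonneg[of 4] by simp
qed

text \<open>The barrier consists of the two diagonal orientations. There both coordinates have
  absolute value \<open>1 / sqrt 2\<close>, and the sum of the half sides is at least twice the
  smaller one.\<close>

lemma rho_TS_STRIP_ge: "ereal (sqrt 2) \<le> rho_TS f_STRIP"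
proof (rule rho_TS_ge_barrier[OF moving_rectangle, of "\<lambda>v. (v $ 1)\<^sup>2 - (v $ 2)\<^sup>2"])
  have half: "1 \<le> sqrt 2 * \<bar>x\<bar>" if "1 / 2 \<le> x\<^sup>2" for x :: real
  proof -
    have "sqrt 1 \<le> sqrt (2 * x\<^sup>2)" using that by (intro real_sqrt_le_mono) simp
    then show ?thesis by (simp add: real_sqrt_mult)
  qed
  have sq: "(v $ 1)\<^sup>2 + (v $ 2)\<^sup>2 = 1" if "norm v = 1" for v :: plane
    using that by (simp add: norm_plane)
  have two: "sqrt 2 * (sqrt 2 * x) = 2 * x" for x by (simp flip: mult.assoc)
  show "continuous_on (sphere 0 1) (\<lambda>v :: plane. (v $ 1)\<^sup>2 - (v $ 2)\<^sup>2)"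
    by (intro continuous_intros)
  show "ereal (sqrt 2) \<le> cost_ratio f_STRIP (orientation_of v) 4 (\<lambda>i. rectangle i 0)"
    if v: "norm v = 1" "(v $ 1)\<^sup>2 - (v $ 2)\<^sup>2 \<le> 0" for v
  proof (rule rectangle_ratio[OF v(1)])
    have "1 \<le> sqrt 2 * \<bar>v $ 2\<bar>" using sq[OF v(1)] v(2) by (intro half) simp
    then have "sqrt 2 * 1 \<le> sqrt 2 * (sqrt 2 * \<bar>v $ 2\<bar>)" by (intro mult_left_mono) auto
    then show "sqrt 2 * min (2 - 0) (1 + 0) \<le> (2 - 0) * \<bar>v $ 2\<bar> + (1 + 0) * \<bar>v $ 1\<bar>"
      unfolding two by simp
  qed simp
  show "ereal (sqrt 2) \<le> cost_ratio f_STRIP (orientation_of v) 4 (\<lambda>i. rectangle i 1)"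
    if v: "norm v = 1" "0 \<le> (v $ 1)\<^sup>2 - (v $ 2)\<^sup>2" for v
  proof (rule rectangle_ratio[OF v(1)])
    have "1 \<le> sqrt 2 * \<bar>v $ 1\<bar>" using sq[OF v(1)] v(2) by (intro half) simp
    then have "sqrt 2 * 1 \<le> sqrt 2 * (sqrt 2 * \<bar>v $ 1\<bar>)" by (intro mult_left_mono) auto
    then show "sqrt 2 * min (2 - 1) (1 + 1) \<le> (2 - 1) * \<bar>v $ 2\<bar> + (1 + 1) * \<bar>v $ 1\<bar>"
      unfolding two by simp
  qed simp
  show "ereal (sqrt 2) \<le> cost_ratio f_STRIP (orientation_of v) 4 (\<lambda>i. rectangle i t)"
    if v: "norm v = 1" "(v $ 1)\<^sup>2 - (v $ 2)\<^sup>2 = 0" and t: "t \<in> {0..1}" for v t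
  proof (rule rectangle_ratio[OF v(1) t])
    have "1 \<le> sqrt 2 * \<bar>v $ 1\<bar>" using sq[OF v(1)] v(2) by (intro half) simp
    then have "sqrt 2 * 1 \<le> sqrt 2 * (sqrt 2 * \<bar>v $ 1\<bar>)" by (intro mult_left_mono) auto
    then have "sqrt 2 * min (2 - t) (1 + t) \<le> (2 * \<bar>v $ 1\<bar>) * min (2 - t) (1 + t)"
      using t unfolding two by (intro mult_right_mono) auto
    also have "\<dots> = \<bar>v $ 1\<bar> * (2 * min (2 - t) (1 + t))" by simp
    also have "\<dots> \<le> \<bar>v $ 1\<bar> * ((2 - t) + (1 + t))" by (intro mult_left_mono) (auto simp: min_def)
    also have "\<dots> = (2 - t) * \<bar>v $ 2\<bar> + (1 + t) * \<bar>v $ 1\<bar>"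
    proof -
      have "\<bar>v $ 1\<bar> = \<bar>v $ 2\<bar>" using v(2) by (simp add: power2_eq_iff abs_eq_iff)
      then show ?thesis by (simp add: algebra_simps)
    qed
    finally show "sqrt 2 * min (2 - t) (1 + t) \<le> (2 - t) * \<bar>v $ 2\<bar> + (1 + t) * \<bar>v $ 1\<bar>" .
  qed
qed simp

text \<open>At time 1 this is the rhombus with diagonals 4 and 2, whose optimal boxes are flush with either pair of
  sides while the boxes at angles 0 and 45 degrees are worse by the factor \<open>5 / 4\<close>.  Shearing it to either side
  breaks the tie but keeps those two areas.\<close>

definition rhombus :: "nat \<Rightarrow> real \<Rightarrow> plane" where
  "rhombus i t = (if i = 0 then vector [2, 0] else if i = 1 then vector [- 2, 0]
     else if i = 2 then vector [1 - t, 1] else vector [t - 1, - 1])"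

lemma moving_rhombus: "moving_point_set 4 2 rhombus"
  unfolding moving_point_set_def
proof (intro conjI allI impI ballI)
  show "continuous_on {0..2} (rhombus i)" for i
    unfolding rhombus_def by (cases "i = 0"; cases "i = 1"; cases "i = 2") (auto intro!: continuous_intros)
  fix t :: real assume "t \<in> {0..2}"
  have "rhombus 0 t \<noteq> rhombus 1 t" by (simp add: rhombus_def plane_eq_iff)
  then show "\<exists>i<4. \<exists>j<4. rhombus i t \<noteq> rhombus j t"
    by (intro exI[of _ 0] exI[of _ 1] conjI) auto
qed simp

text \<open>The area is at least 8 in all cases considered, against at most 32/5 for a competitor.
  On the barrier (multiples of 45 degrees) the bounds used do not involve \<open>t\<close>. At the
  extreme shears the sign condition makes the absolute values add up in one side, so that the area
  is at least 8 times \<open>\<bar>c\<bar> + \<bar>s\<bar>\<close> times the larger of the two,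
  hence at least \<open>8 * (c\<^sup>2 + s\<^sup>2)\<close>.\<close>

lemma rhombus_ratio:
  assumes v: "norm v = 1" and t: "t \<in> {0..2}"
    and g: "v $ 1 * v $ 2 * ((v $ 1)\<^sup>2 - (v $ 2)\<^sup>2) = 0 \<or>
      (1 - t) * (v $ 1 * v $ 2 * ((v $ 1)\<^sup>2 - (v $ 2)\<^sup>2)) \<le> 0 \<and> \<bar>1 - t\<bar> = 1"
  shows "ereal (5 / 4) \<le> cost_ratio f_OBB (orientation_of v) 4 (\<lambda>i. rhombus i t)"
proof -
  let ?P = "\<lambda>i. rhombus i t"
  define c where "c = v $ 1"
  define s where "s = v $ 2"
  define \<sigma> where "\<sigma> = 1 - t"
  define U where "U = width 4 ?P v"
  define W where "W = width 4 ?P (rot90 v)"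
  have cs: "c\<^sup>2 + s\<^sup>2 = 1" using v by (simp add: norm_plane c_def s_def)
  have U: "4 * \<bar>c\<bar> \<le> U" "2 * \<bar>\<sigma> * c + s\<bar> \<le> U"
    using width_ge_abs[of 0 4 1 ?P v] width_ge_abs[of 2 4 3 ?P v]
    by (simp_all add: rhombus_def inner_plane U_def c_def s_def \<sigma>_def algebra_simps abs_if split: if_splits)
  have W: "4 * \<bar>s\<bar> \<le> W" "2 * \<bar>c - \<sigma> * s\<bar> \<le> W"
    using width_ge_abs[of 0 4 1 ?P "rot90 v"] width_ge_abs[of 2 4 3 ?P "rot90 v"]
    by (simp_all add: rhombus_def inner_plane W_def c_def s_def \<sigma>_def algebra_simps abs_if split: if_splits)
  have "8 \<le> U * W"
  proof -
    consider "c = 0" | "s = 0" | "c\<^sup>2 = s\<^sup>2" | "\<bar>\<sigma>\<bar> = 1" "\<sigma> * (c * s) \<le> 0" "\<bar>s\<bar> \<le> \<bar>c\<bar>" | "\<bar>\<sigma>\<bar> = 1" "0 \<le> \<sigma> * (c * s)" "\<bar>c\<bar> \<le> \<bar>s\<bar>"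
    proof (cases "c = 0 \<or> s = 0 \<or> c\<^sup>2 = s\<^sup>2")
      case False
      then have "\<bar>\<sigma>\<bar> = 1" "(\<sigma> * (c * s)) * (c\<^sup>2 - s\<^sup>2) \<le> 0"
        using g by (auto simp: c_def s_def \<sigma>_def mult.assoc)
      show ?thesis
      proof (cases "\<bar>s\<bar> \<le> \<bar>c\<bar>")
        case True
        then have "0 < c\<^sup>2 - s\<^sup>2" using False abs_le_square_iff[of s c] by simp
        then have "\<sigma> * (c * s) \<le> 0" using \<open>(\<sigma> * (c * s)) * (c\<^sup>2 - s\<^sup>2) \<le> 0\<close> by (simp add: mult_le_0_iff)
        then show ?thesis using \<open>\<bar>\<sigma>\<bar> = 1\<close> True that by blast
      next
        case sc: False
        then have "c\<^sup>2 - s\<^sup>2 < 0" using False abs_le_square_iff[of c s] by simp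
        then have "0 \<le> \<sigma> * (c * s)" using \<open>(\<sigma> * (c * s)) * (c\<^sup>2 - s\<^sup>2) \<le> 0\<close> by (simp add: mult_le_0_iff)
        then show ?thesis using \<open>\<bar>\<sigma>\<bar> = 1\<close> sc that by simp
      qed
    qed (use that in blast)
    then show ?thesis
    proof cases
      case 1
      then have "\<bar>s\<bar> = 1" using cs by (auto simp: power2_eq_1_iff)
      then have "2 * 4 \<le> U * W" using U W 1 by (intro mult_mono) auto
      then show ?thesis by simp
    next
      case 2
      then have "\<bar>c\<bar> = 1" using cs by (auto simp: power2_eq_1_iff)
      then have "4 * 2 \<le> U * W" using U W 2 by (intro mult_mono) auto
      then show ?thesis by simp
    next
      case 3
      then have "\<bar>s\<bar> = \<bar>c\<bar>" by (metis power2_eq_iff abs_eq_iff)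
      then have "(4 * \<bar>c\<bar>) * (4 * \<bar>c\<bar>) \<le> U * W" using U W by (intro mult_mono) auto
      moreover have "(4 * \<bar>c\<bar>) * (4 * \<bar>c\<bar>) = 16 * c\<^sup>2" by (simp add: power2_eq_square)
      ultimately show ?thesis using 3 cs by simp
    next
      case 4
      have "\<bar>c - \<sigma> * s\<bar> = \<bar>c\<bar> + \<bar>\<sigma> * s\<bar>"
        using 4(2) mult_le_0_iff[of c "\<sigma> * s"] by (auto simp: mult_ac)
      then have "2 * (\<bar>c\<bar> + \<bar>s\<bar>) \<le> W" using W(2) 4(1) by (simp add: abs_mult)
      then have "(4 * \<bar>c\<bar>) * (2 * (\<bar>c\<bar> + \<bar>s\<bar>)) \<le> U * W" using U by (intro mult_mono) auto
      moreover have "8 * (\<bar>c\<bar> * \<bar>c\<bar> + \<bar>s\<bar> * \<bar>s\<bar>) \<le> 8 * (\<bar>c\<bar> * \<bar>c\<bar> + \<bar>c\<bar> * \<bar>s\<bar>)"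
        using 4(3) by (intro mult_left_mono add_left_mono mult_right_mono) auto
      ultimately show ?thesis using cs by (simp add: power2_eq_square algebra_simps)
    next
      case 5
      have "\<bar>\<sigma> * c + s\<bar> = \<bar>\<sigma> * c\<bar> + \<bar>s\<bar>"
        using 5(2) zero_le_mult_iff[of "\<sigma> * c" s] by (auto simp: mult_ac)
      then have "2 * (\<bar>c\<bar> + \<bar>s\<bar>) \<le> U" using U(2) 5(1) by (simp add: abs_mult)
      then have "(2 * (\<bar>c\<bar> + \<bar>s\<bar>)) * (4 * \<bar>s\<bar>) \<le> U * W" using W by (intro mult_mono) auto
      moreover have "8 * (\<bar>c\<bar> * \<bar>c\<bar> + \<bar>s\<bar> * \<bar>s\<bar>) \<le> 8 * (\<bar>s\<bar> * \<bar>c\<bar> + \<bar>s\<bar> * \<bar>s\<bar>)"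
        using 5(3) by (intro mult_left_mono add_right_mono mult_right_mono) auto
      ultimately show ?thesis using cs by (simp add: power2_eq_square algebra_simps)
    qed
  qed
  then have ge: "8 \<le> f_OBB (orientation_of v) 4 ?P" using v by (simp add: f_OBB_orientation_of U_def W_def)
  \<comment> \<open>Flush with a pair of sides at time 1. Tilted with the sign of the shear, the
    same 8 by 4 box, scaled by \<open>1 / sqrt 5\<close>, still contains the sheared
    rhombus.\<close>
  define u :: plane where "u = (1 / sqrt 5) *\<^sub>R vector [2, if 0 \<le> \<sigma> then 1 else - 1]"
  have u: "norm u = 1" by (simp add: u_def norm_plane power_divide real_sqrt_divide)
  have "width 4 ?P u \<le> 2 * (4 / sqrt 5)"
    using t by (intro width_le_twice)
      (auto dest!: less_4_cases simp: u_def rhombus_def inner_plane \<sigma>_def abs_le_iff field_simps)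
  moreover have "width 4 ?P (rot90 u) \<le> 2 * (2 / sqrt 5)"
    using t by (intro width_le_twice)
      (auto dest!: less_4_cases simp: u_def rhombus_def inner_plane \<sigma>_def abs_le_iff field_simps)
  ultimately have "width 4 ?P u * width 4 ?P (rot90 u) \<le> (2 * (4 / sqrt 5)) * (2 * (2 / sqrt 5))"
    using width_nonneg[of 4] by (intro mult_mono) auto
  then have "5 / 4 * f_OBB (orientation_of u) 4 ?P \<le> f_OBB (orientation_of v) 4 ?P"
    using ge u by (simp add: f_OBB_orientation_of)
  then show ?thesis
    using cost_ratio_ge[of f_OBB 4 ?P "5 / 4"] f_OBB_nonneg[of 4] ge by simp
qed

text \<open>At angle \<open>\<theta>\<close> the barrier function is
  \<open>sin (4 * \<theta>) / 4\<close>, adapted to the quarter turn symmetry of boxes. At times 0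
  and 2 the shear is 1 and -1, so the cheap boxes lie on opposite sides of the barrier.\<close>

lemma rho_TS_OBB_ge: "ereal (5 / 4) \<le> rho_TS f_OBB"
proof (rule rho_TS_ge_barrier[OF moving_rhombus, of "\<lambda>v. v $ 1 * v $ 2 * ((v $ 1)\<^sup>2 - (v $ 2)\<^sup>2)"])
  show "continuous_on (sphere 0 1) (\<lambda>v :: plane. v $ 1 * v $ 2 * ((v $ 1)\<^sup>2 - (v $ 2)\<^sup>2))"
    by (intro continuous_intros)
qed (auto intro!: rhombus_ratio)

text \<open>A cost ratio is never below 1, so any moving point set serves as witness.\<close>

lemma rho_TS_PC_ge: "ereal 1 \<le> rho_TS f_PC"
proof (rule rho_TS_ge[OF moving_rhombus])
  fix a :: "real \<Rightarrow> orientation"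
  show "\<exists>t\<in>{0..2}. ereal 1 \<le> cost_ratio f_PC (a t) 4 (\<lambda>i. rhombus i t)"
    using cost_ratio_ge_1[of f_PC 4 "\<lambda>i. rhombus i 0" "a 0"] f_PC_nonneg[of 4]
    by (intro bexI[of _ 0]) (simp_all add: one_ereal_def)
qed

theorem theorem2:
  shows "rho_TS f_PC = 1 \<and> rho_TS f_OBB = ereal (5 / 4) \<and> rho_TS f_STRIP = ereal (sqrt 2)"
  using rho_TS_PC_le rho_TS_PC_ge rho_TS_OBB_le rho_TS_OBB_ge rho_TS_STRIP_le rho_TS_STRIP_ge
  by (simp add: antisym one_ereal_def)

end
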